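(* Let $n\ge2$ and let $\mathbf p=(p_1,\dots,p_n)$ with $p_i>0$, $\sum_ip_i=1$, be generic. Then $\mathbb E_{\mu_H}[Q_j]=\mathbb E_{\mathrm{unif}^{\otimes n}}[Q_j]$ for every $j\le n-1$, while $$\mathbb E_{\mu_H}[Q_n]-\mathbb E_{\mathrm{unif}^{\otimes n}}[Q_n]=\frac{(-1)^n}{2^n\prod_{i=1}^np_i}\cdot\frac{2\zeta(2n)}{(2\pi^2)^n}\ \ne\ 0.$$
   Context: $\mathbf p$ is called generic if $\{v\in\mathbb Z^n: v\cdot\mathbf p\in\mathbb Z\}=\mathbb Z\cdot(1,\dots,1)$. With $\mathbb T=\mathbb R/\mathbb Z$ (represented by $[0,1)$), $H=\{\theta\in\mathbb T^n:\sum_i\theta_i\equiv0\ (\mathrm{mod}\ 1)\}$ and $\mu_H$ is its Haar probability measure; $\mathrm{unif}^{\otimes n}$ is the law of $n$ independent uniform variables on $[0,1)$. For $\theta\in[0,1)^n$, $$c_k(\theta)=\frac{(-1)^{k+1}}{k(k+1)}\Bigl[B_{k+1}-\sum_{i=1}^n p_i^{-k}B_{k+1}(1-\theta_i)\Bigr]\quad(k\ge1),$$ where $B_k(x)$ are Bernoulli polynomials and $B_k=B_k(0)$, and $Q_j=Q_j(\theta)$ is defined by the formal identity $\exp\bigl(\sum_{k\ge1}c_k(\theta)x^k\bigr)=\sum_{j\ge0}Q_j(\theta)x^j$. $\zeta$ is the Riemann zeta function. (For generic $\mathbf p$ the sequence $\theta(N)=(\{Np_1\},\dots,\{Np_n\})$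 is equidistributed on $H$ by Weyl's theorem, so $\mu_H$-averages are Cesàro means over $N$.) *)

theory Defs
  imports "HOL-Probability.Probability" "HOL-Computational_Algebra.Formal_Power_Series"
begin

text \<open>
  Vectors are functions on the index set \<^term>\<open>{1..n}\<close>; where sets or measures of vectors
  matter they are extensional functions, as in \<^const>\<open>PiM\<close>.
\<close>

definition generic :: "nat \<Rightarrow> (nat \<Rightarrow> real) \<Rightarrow> bool" where
  "generic n p \<longleftrightarrow>
     {v \<in> {1..n} \<rightarrow>\<^sub>E (UNIV :: int set). (\<Sum>i=1..n. of_int (v i) * p i) \<in> \<int>} =
     range (\<lambda>m::int. \<lambda>i\<in>{1..n}. m)"

text \<open>
  Bernoulli polynomials by the generating function
  \<open>t e\<^sup>x\<^sup>t / (e\<^sup>t - 1) = (\<Sum>k. B\<^sub>k(x) t\<^sup>k / k!)\<close>, read as a formal power series in \<open>t\<close>.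
  Both numerator and denominator have a factor \<open>t\<close>, so the quotient of power series is exact
  (\<open>bernoulli_poly_generating_function\<close> below).
\<close>

definition bernoulli_poly :: "nat \<Rightarrow> real \<Rightarrow> real" where
  "bernoulli_poly k x = fact k * fps_nth (fps_X * fps_exp x / (fps_exp 1 - 1)) k"

definition c_coeff :: "nat \<Rightarrow> (nat \<Rightarrow> real) \<Rightarrow> nat \<Rightarrow> (nat \<Rightarrow> real) \<Rightarrow> real" where
  "c_coeff n p k \<theta> = (-1) ^ (k + 1) / (real k * (real k + 1)) *
     (bernoulli_poly (k + 1) 0 - (\<Sum>i=1..n. bernoulli_poly (k + 1) (1 - \<theta> i) / p i ^ k))"

definition Q_coeff :: "nat \<Rightarrow> (nat \<Rightarrow> real) \<Rightarrow> nat \<Rightarrow> (nat \<Rightarrow> real) \<Rightarrow> real" where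
  "Q_coeff n p j \<theta> =
     fps_nth (fps_exp 1 oo Abs_fps (\<lambda>k. if k = 0 then 0 else c_coeff n p k \<theta>)) j"

text \<open>Only meaningful for \<open>s > 1\<close>, where the series converges.\<close>

definition riemann_zeta :: "real \<Rightarrow> real" where
  "riemann_zeta s = (\<Sum>m. 1 / real (Suc m) powr s)"

definition unif_power :: "nat \<Rightarrow> (nat \<Rightarrow> real) measure" where
  "unif_power n = PiM {1..n} (\<lambda>_. uniform_measure lborel {0..<1})"

text \<open>
  The torus \<open>(\<real>/\<int>)\<^sup>n\<close> is represented by \<open>[0,1)\<^sup>n\<close> with addition modulo 1 in each coordinate.
  The representation is a Borel isomorphism, so the Borel sets of the torus are those
  of \<open>\<real>\<^sup>n\<close> restricted to \<open>[0,1)\<^sup>n\<close>.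
\<close>

definition torus_H :: "nat \<Rightarrow> (nat \<Rightarrow> real) set" where
  "torus_H n = {\<theta> \<in> {1..n} \<rightarrow>\<^sub>E {0..<1}. (\<Sum>i=1..n. \<theta> i) \<in> \<int>}"

definition torus_add :: "nat \<Rightarrow> (nat \<Rightarrow> real) \<Rightarrow> (nat \<Rightarrow> real) \<Rightarrow> (nat \<Rightarrow> real)" where
  "torus_add n t \<theta> = (\<lambda>i\<in>{1..n}. frac (t i + \<theta> i))"

definition borel_H :: "nat \<Rightarrow> (nat \<Rightarrow> real) measure" where
  "borel_H n = restrict_space (PiM {1..n} (\<lambda>_. borel)) (torus_H n)"

text \<open>
  The Haar probability measure of \<open>H\<close>: the translation-invariant Borel probability measure.
  Existence is proved below (\<open>haar_prob_H_exists\<close>).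
\<close>

definition haar_prob_H :: "nat \<Rightarrow> (nat \<Rightarrow> real) measure \<Rightarrow> bool" where
  "haar_prob_H n \<mu> \<longleftrightarrow> prob_space \<mu> \<and> sets \<mu> = sets (borel_H n) \<and>
     (\<forall>t\<in>torus_H n. distr \<mu> \<mu> (torus_add n t) = \<mu>)"

lemma bernoulli_poly_generating_function:
  "Abs_fps (\<lambda>k. bernoulli_poly k x / fact k) * (fps_exp 1 - 1) = fps_X * fps_exp x"
proof -
  have nz: "fps_exp (1::real) - 1 \<noteq> 0"
  proof
    assume "fps_exp (1::real) - 1 = 0"
    hence "fps_nth (fps_exp (1::real) - 1) 1 = 0" by simp
    thus False by simp
  qed
  have "subdegree (fps_exp (1::real) - 1) = 1"
    by (rule subdegreeI) auto
  moreover have "subdegree (fps_X * fps_exp x :: real fps) = 1"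
    by (rule subdegreeI) auto
  ultimately have "fps_exp (1::real) - 1 dvd fps_X * fps_exp x"
    using nz by (subst fps_dvd_iff) auto
  moreover have "Abs_fps (\<lambda>k. bernoulli_poly k x / fact k) = fps_X * fps_exp x / (fps_exp 1 - 1)"
    by (rule fps_ext) (simp add: bernoulli_poly_def)
  ultimately show ?thesis by simp
qed

lemma distr_uniform_frac_add:
  "distr (uniform_measure lborel {0..<1}) borel (\<lambda>x. frac (t + x)) =
   uniform_measure lborel {0..<(1::real)}"
proof (rule measure_eqI)
  fix A assume "A \<in> sets (distr (uniform_measure lborel {0..<1::real}) borel (\<lambda>x. frac (t + x)))"
  hence A[measurable]: "A \<in> sets borel" by simp
  define s where "s = frac t"
  have s: "0 \<le> s" "s < 1" by (auto simp: s_def frac_lt_1)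
  have fm[measurable]: "(\<lambda>x::real. frac (t + x)) \<in> borel_measurable borel"
    unfolding frac_def by measurable
  have shift: "emeasure lborel ((+) c -` B) = emeasure lborel B" if [measurable]: "B \<in> sets borel"
    for c :: real and B
  proof -
    have "emeasure lborel B = emeasure (distr lborel borel ((+) c)) B"
      by (simp add: lborel_distr_plus)
    also have "\<dots> = emeasure lborel ((+) c -` B)"
      by (subst emeasure_distr) auto
    finally show ?thesis by simp
  qed
  have eq: "{0..<1} \<inter> (\<lambda>x. frac (t + x)) -` A =
      ((+) s -` (A \<inter> {s..<1})) \<union> ((+) (s - 1) -` (A \<inter> {0..<s}))"
  proof -
    have "frac (t + x) = (if s + x < 1 then s + x else s - 1 + x)" if "0 \<le> x" "x < 1" for x
    proof -
      have "frac x = x" using that by (simp add: frac_eq)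
      then show ?thesis unfolding s_def by (simp add: frac_add)
    qed
    with s show ?thesis by (auto split: if_splits)
  qed
  have disj: "((+) s -` (A \<inter> {s..<1})) \<inter> ((+) (s - 1) -` (A \<inter> {0..<s})) = {}"
    using s by auto
  have vm[measurable]: "(+) c -` B \<in> sets borel" if "B \<in> sets borel" for c :: real and B
    using measurable_sets[of "(+) c" borel borel B] that by simp
  have vA: "(\<lambda>x. frac (t + x)) -` A \<in> sets borel"
    using measurable_sets[OF fm A] by simp
  have "emeasure (distr (uniform_measure lborel {0..<1}) borel (\<lambda>x. frac (t + x))) A =
      emeasure lborel ({0..<1} \<inter> (\<lambda>x. frac (t + x)) -` A)"
    using vA by (subst emeasure_distr) (auto simp: divide_ennreal_def)
  also have "\<dots> = emeasure lborel (A \<inter> {s..<1}) + emeasure lborel (A \<inter> {0..<s})"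
    unfolding eq using disj by (subst plus_emeasure[symmetric]) (auto simp: shift simp del: vimage_Int)
  also have "\<dots> = emeasure lborel ((A \<inter> {s..<1}) \<union> (A \<inter> {0..<s}))"
    by (rule plus_emeasure) auto
  also have "(A \<inter> {s..<1}) \<union> (A \<inter> {0..<s}) = {0..<1} \<inter> A" using s by auto
  also have "emeasure lborel ({0..<1} \<inter> A) = emeasure (uniform_measure lborel {0..<1}) A"
    by (simp add: divide_ennreal_def)
  finally show "emeasure (distr (uniform_measure lborel {0..<1}) borel (\<lambda>x. frac (t + x))) A =
      emeasure (uniform_measure lborel {0..<1}) A" .
qed simp

lemma prob_space_unif: "prob_space (uniform_measure lborel {0..<(1::real)})"
  by (rule prob_space_uniform_measure) auto

lemma prob_space_unif_power: "prob_space (unif_power n)"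
  unfolding unif_power_def by (intro prob_space_PiM prob_space_unif)

lemma sets_unif_power: "sets (unif_power n) = sets (PiM {1..n} (\<lambda>_. borel))"
  unfolding unif_power_def by (rule sets_PiM_cong) auto

lemma measurable_frac [measurable]: "(frac :: real \<Rightarrow> real) \<in> borel_measurable borel"
  unfolding frac_def by measurable

lemma measurable_torus_add:
  "torus_add n t \<in> measurable (PiM {1..n} (\<lambda>_. borel)) (PiM {1..n} (\<lambda>_. borel))"
  unfolding torus_add_def by (intro measurable_restrict) measurable

lemma distr_unif_power_torus_add: "distr (unif_power n) (unif_power n) (torus_add n t) = unif_power n"
proof -
  interpret product_sigma_finite "\<lambda>_::nat. uniform_measure lborel {0..<(1::real)}"
    using prob_space_unif by (simp add: product_sigma_finite_def prob_space_imp_sigma_finite)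
  have meas: "torus_add n t \<in> measurable (unif_power n) (unif_power n)"
    using measurable_torus_add by (simp cong: measurable_cong_sets add: sets_unif_power)
  show ?thesis
  proof (subst (3) unif_power_def, rule PiM_eqI)
    fix A :: "nat \<Rightarrow> real set"
    assume A': "\<And>i. i \<in> {1..n} \<Longrightarrow> A i \<in> sets (uniform_measure lborel {0..<(1::real)})"
    hence A: "\<And>i. i \<in> {1..n} \<Longrightarrow> A i \<in> sets borel" by simp
    have vA: "(\<lambda>x. frac (t i + x)) -` A i \<in> sets borel" if "i \<in> {1..n}" for i
      using measurable_sets[of "\<lambda>x. frac (t i + x)" borel borel "A i"] A[OF that] by simp
    have "Pi\<^sub>E {1..n} A \<in> sets (unif_power n)"
      unfolding unif_power_def using A' by (intro sets_PiM_I_finite) auto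
    hence "emeasure (distr (unif_power n) (unif_power n) (torus_add n t)) (Pi\<^sub>E {1..n} A) =
       emeasure (unif_power n) (torus_add n t -` Pi\<^sub>E {1..n} A \<inter> space (unif_power n))"
      using meas by (subst emeasure_distr) auto
    also have "torus_add n t -` Pi\<^sub>E {1..n} A \<inter> space (unif_power n) =
        (\<Pi>\<^sub>E i\<in>{1..n}. (\<lambda>x. frac (t i + x)) -` A i)"
      unfolding torus_add_def unif_power_def space_PiM
      by (auto simp: PiE_iff extensional_def)
    also have "emeasure (unif_power n) \<dots> =
        (\<Prod>i=1..n. emeasure (uniform_measure lborel {0..<1}) ((\<lambda>x. frac (t i + x)) -` A i))"
      unfolding unif_power_def using vA by (intro emeasure_PiM) auto
    also have "\<dots> = (\<Prod>i=1..n. emeasure (uniform_measure lborel {0..<1}) (A i))"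
    proof (rule prod.cong)
      fix i assume i: "i \<in> {1..n}"
      have "emeasure (uniform_measure lborel {0..<1}) (A i) =
         emeasure (distr (uniform_measure lborel {0..<1}) borel (\<lambda>x. frac (t i + x))) (A i)"
        by (simp only: distr_uniform_frac_add)
      also have "\<dots> = emeasure (uniform_measure lborel {0..<1}) ((\<lambda>x. frac (t i + x)) -` A i)"
        using A[OF i] by (subst emeasure_distr) auto
      finally show "emeasure (uniform_measure lborel {0..<1}) ((\<lambda>x. frac (t i + x)) -` A i) =
        emeasure (uniform_measure lborel {0..<1}) (A i)" ..
    qed simp
    finally show "emeasure (distr (unif_power n) (unif_power n) (torus_add n t)) (Pi\<^sub>E {1..n} A) =
       (\<Prod>i\<in>{1..n}. emeasure (uniform_measure lborel {0..<1}) (A i))" .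
  qed (auto simp: unif_power_def)
qed

lemma Ints_cong_diff: "(a::real) - b \<in> \<int> \<Longrightarrow> a \<in> \<int> \<longleftrightarrow> b \<in> \<int>"
  by (metis Ints_add Ints_diff add_diff_cancel_left' diff_add_cancel diff_diff_eq2)

lemma frac_cong: "(a::real) - b \<in> \<int> \<Longrightarrow> frac a = frac b"
  by (metis Ints_cases add.commute diff_add_cancel frac_add_simps(1) frac_of_int add_0)

lemma diff_frac_Ints: "(x::real) - frac x \<in> \<int>"
  by (simp add: frac_def)

lemma torus_add_in_H:
  assumes "t \<in> torus_H n" "\<theta> \<in> torus_H n"
  shows "torus_add n t \<theta> \<in> torus_H n"
proof -
  have "(\<Sum>i=1..n. t i + \<theta> i) - (\<Sum>i=1..n. frac (t i + \<theta> i)) \<in> \<int>"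
    unfolding sum_subtractf[symmetric] by (intro Ints_sum diff_frac_Ints)
  moreover have "(\<Sum>i=1..n. t i + \<theta> i) \<in> \<int>"
    using assms by (auto simp: torus_H_def sum.distrib)
  ultimately have "(\<Sum>i=1..n. frac (t i + \<theta> i)) \<in> \<int>"
    using Ints_cong_diff by blast
  thus ?thesis by (auto simp: torus_H_def torus_add_def frac_lt_1)
qed

lemma haar_prob_H_exists:
  assumes "n \<ge> 1"
  shows "\<exists>\<mu>. haar_prob_H n \<mu>"
proof -
  define \<Phi> :: "(nat \<Rightarrow> real) \<Rightarrow> nat \<Rightarrow> real" where
    "\<Phi> \<theta> = (\<lambda>i\<in>{1..n}. if i = n then frac (- (\<Sum>j\<in>{1..<n}. \<theta> j)) else frac (\<theta> i))" for \<theta>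
  have split: "{1..n} = insert n {1..<n}" using assms by auto
  have \<Phi>_H: "\<Phi> \<theta> \<in> torus_H n" for \<theta>
  proof -
    have "(\<Sum>i=1..n. \<Phi> \<theta> i) = frac (- (\<Sum>j\<in>{1..<n}. \<theta> j)) + (\<Sum>j\<in>{1..<n}. frac (\<theta> j))"
      unfolding split by (subst sum.insert) (use assms in \<open>auto simp: \<Phi>_def intro!: sum.cong\<close>)
    also have "\<dots> = - ((- (\<Sum>j\<in>{1..<n}. \<theta> j) - frac (- (\<Sum>j\<in>{1..<n}. \<theta> j)))
                    + (\<Sum>j\<in>{1..<n}. \<theta> j - frac (\<theta> j)))"
      by (simp add: sum_subtractf)
    also have "\<dots> \<in> \<int>"
      by (intro Ints_minus Ints_add Ints_sum diff_frac_Ints)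
    finally show ?thesis
      by (auto simp: torus_H_def) (auto simp: \<Phi>_def frac_lt_1)
  qed
  have \<Phi>_add: "\<Phi> (torus_add n t \<theta>) = torus_add n t (\<Phi> \<theta>)" if t: "t \<in> torus_H n" for t \<theta>
  proof
    fix i
    have sums: "(\<Sum>i=1..n. t i) = t n + (\<Sum>j\<in>{1..<n}. t j)"
      unfolding split by (subst sum.insert) auto
    have "(\<Sum>j\<in>{1..<n}. torus_add n t \<theta> j) = (\<Sum>j\<in>{1..<n}. frac (t j + \<theta> j))"
      by (intro sum.cong) (auto simp: torus_add_def)
    moreover have "frac (- (\<Sum>j\<in>{1..<n}. frac (t j + \<theta> j))) = frac (t n + - (\<Sum>j\<in>{1..<n}. \<theta> j))"
    proof (rule frac_cong)
      have "- (\<Sum>j\<in>{1..<n}. frac (t j + \<theta> j)) - (t n + - (\<Sum>j\<in>{1..<n}. \<theta> j)) =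
        (\<Sum>j\<in>{1..<n}. (t j + \<theta> j) - frac (t j + \<theta> j)) - (\<Sum>i=1..n. t i)"
        unfolding sums by (simp add: sum_subtractf sum.distrib)
      also have "\<dots> \<in> \<int>"
        using t by (intro Ints_diff[OF Ints_sum] diff_frac_Ints) (simp add: torus_H_def)
      finally show "- (\<Sum>j\<in>{1..<n}. frac (t j + \<theta> j)) - (t n + - (\<Sum>j\<in>{1..<n}. \<theta> j)) \<in> \<int>" .
    qed
    ultimately show "\<Phi> (torus_add n t \<theta>) i = torus_add n t (\<Phi> \<theta>) i"
      using assms by (auto simp: \<Phi>_def torus_add_def)
  qed
  have \<Phi>_meas0: "\<Phi> \<in> measurable (PiM {1..n} (\<lambda>_. borel)) (PiM {1..n} (\<lambda>_. borel))"
  proof -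
    have c: "(\<lambda>\<theta>. \<theta> j) \<in> borel_measurable (PiM {1..n} (\<lambda>_. borel :: real measure))"
      if "j \<in> {1..n}" for j using that by measurable
    have "(\<lambda>\<theta>. if i = n then frac (- (\<Sum>j\<in>{1..<n}. \<theta> j)) else frac (\<theta> i))
         \<in> borel_measurable (PiM {1..n} (\<lambda>_. borel :: real measure))" if "i \<in> {1..n}" for i
    proof -
      have "(\<lambda>\<theta>. - (\<Sum>j\<in>{1..<n}. \<theta> j)) \<in> borel_measurable (PiM {1..n} (\<lambda>_. borel :: real measure))"
        by (intro borel_measurable_uminus borel_measurable_sum c) auto
      from measurable_compose[OF this measurable_frac] measurable_compose[OF c[OF that] measurable_frac]
      show ?thesis by (cases "i = n") simp_all
    qed
    thus ?thesis unfolding \<Phi>_def by (intro measurable_restrict) auto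
  qed
  have \<Phi>_meas: "\<Phi> \<in> measurable (unif_power n) (borel_H n)"
    unfolding borel_H_def
    using \<Phi>_meas0 \<Phi>_H
    by (intro measurable_restrict_space2) (auto cong: measurable_cong_sets simp: sets_unif_power)
  have T_meas: "torus_add n t \<in> measurable (borel_H n) (borel_H n)" if "t \<in> torus_H n" for t
    unfolding borel_H_def
    by (intro measurable_restrict_space2 measurable_restrict_space1 measurable_torus_add)
       (use that torus_add_in_H in \<open>auto simp: space_restrict_space\<close>)
  have S_meas: "torus_add n t \<in> measurable (unif_power n) (unif_power n)" for t
    using measurable_torus_add by (simp cong: measurable_cong_sets add: sets_unif_power)
  define \<mu> where "\<mu> = distr (unif_power n) (borel_H n) \<Phi>"
  have "prob_space \<mu>"
    unfolding \<mu>_def using prob_space_unif_power \<Phi>_meas by (rule prob_space.prob_space_distr)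
  moreover have sets: "sets \<mu> = sets (borel_H n)" by (simp add: \<mu>_def)
  moreover have "distr \<mu> \<mu> (torus_add n t) = \<mu>" if t: "t \<in> torus_H n" for t
  proof -
    have "distr \<mu> \<mu> (torus_add n t) = distr \<mu> (borel_H n) (torus_add n t)"
      by (rule distr_cong) (auto simp: sets)
    also have "\<dots> = distr (unif_power n) (borel_H n) (torus_add n t \<circ> \<Phi>)"
      unfolding \<mu>_def using T_meas[OF t] \<Phi>_meas by (rule distr_distr)
    also have "torus_add n t \<circ> \<Phi> = \<Phi> \<circ> torus_add n t"
      using \<Phi>_add[OF t] by auto
    also have "distr (unif_power n) (borel_H n) (\<Phi> \<circ> torus_add n t) =
        distr (distr (unif_power n) (unif_power n) (torus_add n t)) (borel_H n) \<Phi>"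
      using \<Phi>_meas S_meas by (rule distr_distr[symmetric])
    also have "\<dots> = \<mu>" by (simp add: distr_unif_power_torus_add \<mu>_def)
    finally show ?thesis .
  qed
  ultimately show ?thesis unfolding haar_prob_H_def by blast
qed

end

theory Submission
  imports Defs
begin

text \<open>
  The exponential of \<open>\<Sum>c\<^sub>k x\<^sup>k\<close> factors as \<open>A(x) \<Prod>\<^sub>i F\<^sub>i(\<theta>\<^sub>i, x)\<close> with constant terms 1. Expand
  \<open>\<Prod>\<^sub>i (1 + (F\<^sub>i - 1))\<close> over the subsets \<open>S\<close> of \<open>{1..n}\<close>. Under the Haar measure of \<open>H\<close> any \<open>n - 1\<close>
  coordinates are independent and uniform, so a term with \<open>S \<noteq> {1..n}\<close> has the same mean under
  both measures. The remaining term starts in degree \<open>n\<close>, with coefficient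
  \<open>\<Prod>\<^sub>i (-B\<^sub>2(\<theta>\<^sub>i) / (2p\<^sub>i))\<close>. Its uniform mean vanishes. For its Haar mean expand the last factor as
  \<open>B\<^sub>2(\<theta>\<^sub>n) = \<Sum>\<^sub>m cos(2\<pi>m\<theta>\<^sub>n) / (\<pi>m)\<^sup>2\<close>; on \<open>H\<close> the character \<open>e(m\<theta>\<^sub>n)\<close> is the product of the
  \<open>e(-m\<theta>\<^sub>i)\<close> with \<open>i < n\<close>, so the \<open>m\<close>-th summand integrates to a product of Fourier coefficients
  \<open>1 / (2\<pi>\<^sup>2m\<^sup>2)\<close>.
\<close>

section \<open>Exponentials and products of formal power series\<close>

text \<open>The difference \<open>h\<close> solves the same equation with \<open>h(0) = 0\<close>.
  Coefficient \<open>m\<close> of \<open>h' = h c\<close> expresses \<open>(m + 1) h_(m+1)\<close>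
  by earlier coefficients of \<open>h\<close>, and characteristic 0 permits dividing by
  \<open>m + 1\<close>.\<close>

lemma fps_linear_ODE_unique:
  fixes f g c :: "'a::field_char_0 fps"
  assumes "fps_deriv f = f * c" "fps_deriv g = g * c" "fps_nth f 0 = fps_nth g 0"
  shows "f = g"
proof -
  define h where "h = f - g"
  have h: "fps_deriv h = h * c" using assms(1,2) by (simp add: h_def algebra_simps)
  have "fps_nth h n = 0" for n
  proof (induction n rule: less_induct)
    case (less n)
    show ?case
    proof (cases n)
      case 0
      then show ?thesis using assms(3) by (simp add: h_def)
    next
      case (Suc m)
      have "of_nat (Suc m) * fps_nth h (Suc m) = fps_nth (h * c) m"
        using h by (metis fps_deriv_nth Suc_eq_plus1)
      also have "\<dots> = 0" using less Suc by (simp add: fps_mult_nth)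
      finally show ?thesis using Suc by (simp del: of_nat_Suc)
    qed
  qed
  then have "h = 0" by (simp add: fps_eq_iff)
  then show ?thesis by (simp add: h_def)
qed

text \<open>Both sides solve \<open>y' = y (a' + b')\<close> with constant term 1. The vanishing
  constant terms of \<open>a\<close> and \<open>b\<close> are what the chain rule for composition
  requires.\<close>

lemma fps_exp_compose_add:
  fixes a b :: "'a::field_char_0 fps"
  assumes "fps_nth a 0 = 0" "fps_nth b 0 = 0"
  shows "fps_exp 1 oo (a + b) = (fps_exp 1 oo a) * (fps_exp 1 oo b)"
  by (rule fps_linear_ODE_unique[where c = "fps_deriv a + fps_deriv b"])
     (use assms in \<open>auto simp: fps_compose_deriv algebra_simps\<close>)

lemma fps_exp_compose_sum:
  fixes a :: "'i \<Rightarrow> 'a::field_char_0 fps"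
  assumes "finite I" "\<And>i. i \<in> I \<Longrightarrow> fps_nth (a i) 0 = 0"
  shows "fps_exp 1 oo (\<Sum>i\<in>I. a i) = (\<Prod>i\<in>I. fps_exp 1 oo a i)"
  using assms
proof (induction I rule: finite_induct)
  case (insert i I)
  then show ?case by (simp add: fps_exp_compose_add fps_sum_nth)
qed simp

text \<open>Each factor has order at least 1, so the orders add up to at least
  \<open>card S\<close>, and degree exactly \<open>card S\<close> is reached only by taking the
  linear coefficient of every factor.\<close>

lemma fps_nth_prod_lowest:
  fixes h :: "'i \<Rightarrow> 'a::comm_ring_1 fps"
  assumes "finite S" "\<And>i. i \<in> S \<Longrightarrow> fps_nth (h i) 0 = 0"
  shows "(\<forall>j<card S. fps_nth (\<Prod>i\<in>S. h i) j = 0) \<and>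
    fps_nth (\<Prod>i\<in>S. h i) (card S) = (\<Prod>i\<in>S. fps_nth (h i) 1)"
  using assms
proof (induction S rule: finite_induct)
  case (insert i S)
  let ?P = "\<Prod>i\<in>S. h i"
  have IH: "\<forall>j<card S. fps_nth ?P j = 0" "fps_nth ?P (card S) = (\<Prod>i\<in>S. fps_nth (h i) 1)"
    using insert by auto
  have z: "fps_nth (h i) 0 = 0" using insert by auto
  have "fps_nth (h i * ?P) j = 0" if "j < Suc (card S)" for j
    unfolding fps_mult_nth
  proof (rule sum.neutral, rule ballI)
    fix k assume "k \<in> {0..j}"
    then show "fps_nth (h i) k * fps_nth ?P (j - k) = 0"
      using IH(1) z that by (cases k) auto
  qed
  moreover have "fps_nth (h i * ?P) (Suc (card S)) = fps_nth (h i) 1 * fps_nth ?P (card S)"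
  proof -
    have "fps_nth (h i * ?P) (Suc (card S)) =
        (\<Sum>k\<in>{0..Suc (card S)}. if k = 1 then fps_nth (h i) 1 * fps_nth ?P (card S) else 0)"
      unfolding fps_mult_nth
    proof (rule sum.cong)
      fix k assume "k \<in> {0..Suc (card S)}"
      \<comment> \<open>\<open>k = 0\<close> is killed by \<open>h i\<close>, and
        \<open>k \<ge> 2\<close> leaves an index below \<open>card S\<close> in \<open>?P\<close>,
        so only \<open>k = 1\<close> survives.\<close>
      moreover have "k = 0 \<or> k = 1 \<or> k \<ge> 2" by linarith
      ultimately show "fps_nth (h i) k * fps_nth ?P (Suc (card S) - k) =
          (if k = 1 then fps_nth (h i) 1 * fps_nth ?P (card S) else 0)"
        using IH(1) z by auto
    qed simp
    then show ?thesis by simp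
  qed
  ultimately show ?case using insert(1,2) IH(2) by simp
qed simp

section \<open>Bernoulli polynomials and the Fourier series of \<open>B\<^sub>2\<close>\<close>

lemma bernoulli_poly_2: "bernoulli_poly 2 x = x\<^sup>2 - x + 1/6"
proof -
  define \<beta> where "\<beta> k = bernoulli_poly k x / fact k" for k
  have *: "fps_nth (Abs_fps \<beta> * (fps_exp 1 - 1)) k = fps_nth (fps_X * fps_exp x) k" for k
    unfolding \<beta>_def by (simp only: bernoulli_poly_generating_function)
  \<comment> \<open>Since \<open>fps_exp 1 - 1\<close> has no constant term, coefficient
    \<open>k\<close> involves only \<open>\<beta> 0\<close> to \<open>\<beta> (k - 1)\<close>;
    coefficients 1 to 3 form a triangular system for the first three values.\<close>
  from *[of 1] *[of 2] *[of 3] have "\<beta> 0 = 1" "\<beta> 0 / 2 + \<beta> 1 = x" "\<beta> 0 / 6 + \<beta> 1 / 2 + \<beta> 2 = x\<^sup>2 / 2"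
    by (auto simp: fps_mult_nth numeral_eq_Suc fact_numeral)
  then have "\<beta> 2 = x\<^sup>2 / 2 - x / 2 + 1 / 12" by (simp add: field_simps)
  then show ?thesis by (simp add: \<beta>_def field_simps)
qed

text \<open>Divisibility of \<open>fps_X\<close> by \<open>fps_exp 1 - 1\<close> lets the quotient
  split as \<open>t / (e^t - 1)\<close> times \<open>e^(xt)\<close>. Each coefficient is then a
  Cauchy product, visibly a polynomial in \<open>x\<close>.\<close>

lemma continuous_on_bernoulli_poly [continuous_intros]:
  assumes "continuous_on S f"
  shows "continuous_on S (\<lambda>x. bernoulli_poly k (f x))"
proof -
  have nz: "fps_exp (1::real) - 1 \<noteq> 0"
  proof
    assume "fps_exp (1::real) - 1 = 0"
    hence "fps_nth (fps_exp (1::real) - 1) 1 = 0" by simp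
    thus False by simp
  qed
  have "subdegree (fps_exp (1::real) - 1) = 1"
    by (rule subdegreeI) auto
  then have "fps_exp (1::real) - 1 dvd fps_X"
    using nz by (subst fps_dvd_iff) auto
  then have "fps_X * fps_exp x / (fps_exp 1 - 1) = fps_X / (fps_exp 1 - 1) * fps_exp x" for x :: real
    by (simp add: dvd_div_mult)
  then show ?thesis
    unfolding bernoulli_poly_def using assms
    by (simp only: fps_mult_nth fps_exp_nth) (intro continuous_intros; simp)
qed

text \<open>The dilogarithm \<open>Li_2\<close> on the closed unit disc. The summand at
  \<open>m = 0\<close> is \<open>1 / 0 = 0\<close>, so the series effectively starts at
  \<open>m = 1\<close>.\<close>

definition dilog :: "complex \<Rightarrow> complex" where
  "dilog z = (\<Sum>m. z ^ m / of_nat m ^ 2)"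

lemma summable_inverse_square: "summable (\<lambda>m. 1 / real m ^ 2)"
  using inverse_power_summable[of 2, where 'a = real] by (simp add: inverse_eq_divide)

lemma norm_dilog_term_le:
  fixes z :: complex
  assumes "norm z \<le> 1"
  shows "norm (z ^ m / of_nat m ^ 2) \<le> 1 / real m ^ 2"
proof -
  have "norm z ^ m / real m ^ 2 \<le> 1 / real m ^ 2"
    using assms by (intro divide_right_mono power_le_one) auto
  then show ?thesis by (simp add: norm_divide norm_power)
qed

lemma Re_dilog_term: "Re (z ^ m / of_nat m ^ 2) = Re (z ^ m) / real m ^ 2"
  using Re_divide_of_real[of "z ^ m" "real m ^ 2"] by simp

lemma dilog_sums:
  assumes "norm z \<le> 1"
  shows "(\<lambda>m. z ^ m / of_nat m ^ 2) sums dilog z"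
  unfolding dilog_def
  by (intro summable_sums summable_comparison_test'[OF summable_inverse_square, of 0]
      norm_dilog_term_le assms)

text \<open>The M-test with majorant \<open>1 / m^2\<close> works up to and including the unit
  circle; continuity there is what the radial limit in the Abel summation uses.\<close>

lemma continuous_on_dilog: "continuous_on (cball 0 1) dilog"
proof (rule uniform_limit_theorem)
  show "uniform_limit (cball 0 1) (\<lambda>n z. \<Sum>m<n. z ^ m / of_nat m ^ 2) dilog sequentially"
    unfolding dilog_def[abs_def]
    by (rule Weierstrass_m_test[OF _ summable_inverse_square]) (simp add: norm_dilog_term_le)
  show "\<forall>\<^sub>F n in sequentially. continuous_on (cball 0 1) (\<lambda>z::complex. \<Sum>m<n. z ^ m / of_nat m ^ 2)"
    by (intro always_eventually allI continuous_on_sum)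
       (simp only: divide_inverse, intro continuous_intros)
qed auto

text \<open>Termwise differentiation cancels one factor \<open>m\<close> and leaves the logarithm
  series. The relation is kept multiplied by \<open>z\<close>, which avoids a division at
  \<open>z = 0\<close>.\<close>

lemma dilog_deriv:
  assumes "norm z < 1"
  obtains d where "(dilog has_field_derivative d) (at z)" "z * d = - Ln (1 - z)"
proof
  let ?c = "\<lambda>m. 1 / of_nat m ^ 2 :: complex"
  let ?d = "\<Sum>m. diffs ?c m * z ^ m"
  have s: "summable (\<lambda>m. ?c m * w ^ m)" if "norm w < 1" for w
    using dilog_sums[of w] that by (simp add: sums_iff)
  have "((\<lambda>z. \<Sum>m. ?c m * z ^ m) has_field_derivative ?d) (at z)"
    using s assms by (rule termdiffs_strong')
  moreover have "(\<lambda>z. \<Sum>m. ?c m * z ^ m) = dilog" by (simp add: dilog_def[abs_def])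
  ultimately show "(dilog has_field_derivative ?d) (at z)" by simp
  have "summable (\<lambda>m. diffs ?c m * z ^ m)"
    using assms s by (rule termdiff_converges)
  then have "(\<lambda>m. z * (diffs ?c m * z ^ m)) sums (z * ?d)"
    by (intro sums_mult summable_sums)
  moreover have "z * (diffs ?c m * z ^ m) = z ^ Suc m / of_nat (Suc m)" for m
    by (simp add: diffs_def power2_eq_square del: of_nat_Suc)
  ultimately have "(\<lambda>m. z ^ Suc m / of_nat (Suc m)) sums (z * ?d)" by simp
  \<comment> \<open>The added term at index 0 is \<open>1 / 0 = 0\<close>, so undoing the shift
    leaves the sum unchanged.\<close>
  then have "(\<lambda>m. z ^ m / of_nat m) sums (z * ?d)"
    by (subst (asm) sums_Suc_iff) simp
  moreover have "(\<lambda>m. - (z ^ m / of_nat m)) sums Ln (1 - z)"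
    using Ln_series'[of "- z"] assms by simp
  from sums_minus[OF this] have "(\<lambda>m. z ^ m / of_nat m) sums - Ln (1 - z)" by simp
  ultimately show "z * ?d = - Ln (1 - z)" by (rule sums_unique2)
qed

text \<open>In polar form \<open>1 - e^(2 pi i y)\<close> has modulus \<open>2 sin(pi y) > 0\<close>
  and argument \<open>pi (y - 1/2)\<close>. This argument lies in the principal range, so
  \<open>Ln\<close> returns it.\<close>

lemma Im_Ln_one_minus_exp:
  assumes "0 < y" "y < 1"
  shows "Im (Ln (1 - exp (2 * pi * \<i> * y))) = pi * (y - 1 / 2)"
proof -
  let ?w = "\<i> * complex_of_real (pi * (y - 1 / 2))"
  have pos: "sin (pi * y) > 0" using assms by (intro sin_gt_zero) auto
  have "1 - exp (2 * pi * \<i> * y) = of_real (2 * sin (pi * y)) * exp ?w"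
  proof (rule complex_eqI)
    have e: "exp (2 * pi * \<i> * y) = cis (2 * (pi * y))" by (simp add: cis_conv_exp mult_ac)
    have w: "exp ?w = cis (pi * y - pi / 2)" by (simp add: cis_conv_exp algebra_simps)
    show "Re (1 - exp (2 * pi * \<i> * y)) = Re (of_real (2 * sin (pi * y)) * exp ?w)"
      unfolding e w by (simp add: cos_diff cos_double_sin power2_eq_square)
    show "Im (1 - exp (2 * pi * \<i> * y)) = Im (of_real (2 * sin (pi * y)) * exp ?w)"
      unfolding e w by (simp add: sin_diff sin_double)
  qed
  also have "Ln \<dots> = of_real (ln (2 * sin (pi * y))) + Ln (exp ?w)"
    using Ln_times_of_real[of "2 * sin (pi * y)" "exp ?w"] Ln_of_real[of "2 * sin (pi * y)"] pos
    by (simp only: zero_less_mult_iff exp_not_eq_zero) simp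
  also have "Ln (exp ?w) = ?w"
  proof (rule Ln_exp)
    have "pi * (y - 1 / 2) \<le> pi * 1" by (rule mult_left_mono) (use assms in auto)
    then show "Im ?w \<le> pi" by simp
    have "pi * (- 1) < pi * (y - 1 / 2)" by (rule mult_strict_left_mono) (use assms in auto)
    then show "- pi < Im ?w" by simp
  qed
  finally show ?thesis by simp
qed

text \<open>
  Abel summation: inside the unit disc the derivative of \<open>Re (dilog (r e\<^sup>2\<^sup>\<pi>\<^sup>i\<^sup>x))\<close> in \<open>x\<close> is
  \<open>2\<pi> Im (Ln (1 - r e\<^sup>2\<^sup>\<pi>\<^sup>i\<^sup>x))\<close>, which is bounded and tends to \<open>\<pi>\<^sup>2(2x - 1)\<close> as \<open>r\<close> tends to 1.
\<close>

lemma Re_dilog_exp: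
  assumes x: "0 \<le> x" "x \<le> 1"
  shows "Re (dilog (exp (2 * pi * \<i> * x))) = pi\<^sup>2 * (x\<^sup>2 - x + 1 / 6)"
proof -
  define e where "e y = exp (2 * pi * \<i> * complex_of_real y)" for y
  \<comment> \<open>Radii increasing to 1; the shift by 2 keeps them strictly between 0 and 1
    already at \<open>k = 0\<close>.\<close>
  define r where "r k = 1 - 1 / real (k + 2)" for k
  have ne: "norm (e y) = 1" for y by (simp add: e_def norm_exp_eq_Re)
  have r01: "0 < r k" "r k < 1" for k by (auto simp: r_def field_simps)
  have "(\<lambda>k. 1 / real (k + 2)) \<longlonglongrightarrow> 0"
    using LIMSEQ_ignore_initial_segment[OF lim_1_over_n[where 'a = real], of 2] by simp
  then have r_lim: "r \<longlonglongrightarrow> 1"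
    unfolding r_def[abs_def] using tendsto_diff[OF tendsto_const[of 1]] by force
  have z_lim: "(\<lambda>k. of_real (r k) * e y) \<longlonglongrightarrow> e y" for y
    using tendsto_mult[OF tendsto_of_real[OF r_lim] tendsto_const[of "e y"]] by simp
  have z1: "norm (of_real (r k) * e y) < 1" for k y
    using r01[of k] by (simp add: norm_mult ne)
  define f where "f k y = Re (dilog (of_real (r k) * e y))" for k y
  define f' where "f' k y = 2 * pi * Im (Ln (1 - of_real (r k) * e y))" for k y
  \<comment> \<open>At the endpoints \<open>e y = 1\<close>, so the logarithm is taken of a positive
    real and its imaginary part is 0 for every radius. Hence the pointwise limit there is 0 and not
    the value of the polynomial.\<close>
  define g where "g y = (if y \<in> {0, 1} then 0 else pi\<^sup>2 * (2 * y - 1))" for y :: real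
  have f_lim: "(\<lambda>k. f k y) \<longlonglongrightarrow> Re (dilog (e y))" for y
    unfolding f_def
  proof (rule tendsto_Re, rule continuous_on_tendsto_compose[OF continuous_on_dilog z_lim])
    show "\<forall>\<^sub>F k in sequentially. of_real (r k) * e y \<in> cball 0 1"
      using z1 by (auto intro!: always_eventually less_imp_le)
  qed (simp add: ne)
  have deriv: "(f k has_vector_derivative f' k y) (at y within S)" for k y S
  proof -
    obtain d where d: "(dilog has_field_derivative d) (at (of_real (r k) * e y))"
      "of_real (r k) * e y * d = - Ln (1 - of_real (r k) * e y)"
      using dilog_deriv[OF z1] .
    have "((\<lambda>w. of_real (r k) * exp (2 * pi * \<i> * w)) has_field_derivative
        2 * pi * \<i> * (of_real (r k) * e y)) (at (of_real y))"
      by (auto simp: e_def intro!: derivative_eq_intros)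
    from DERIV_chain2[OF d(1)[unfolded e_def] this]
    have "((\<lambda>w. dilog (of_real (r k) * exp (2 * pi * \<i> * w))) has_field_derivative
        d * (2 * pi * \<i> * (of_real (r k) * e y))) (at (of_real y))"
      by simp
    also have "d * (2 * pi * \<i> * (of_real (r k) * e y)) = 2 * pi * \<i> * (of_real (r k) * e y * d)"
      by (simp only: mult_ac)
    also have "\<dots> = - (2 * pi * \<i> * Ln (1 - of_real (r k) * e y))"
      unfolding d(2) by simp
    finally have "((\<lambda>y. dilog (of_real (r k) * e y)) has_vector_derivative
        - (2 * pi * \<i> * Ln (1 - of_real (r k) * e y))) (at y within S)"
      unfolding e_def by (rule has_vector_derivative_real_field)
    then have "((\<lambda>y. Re (dilog (of_real (r k) * e y))) has_vector_derivative
        Re (- (2 * pi * \<i> * Ln (1 - of_real (r k) * e y)))) (at y within S)"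
      by (rule bounded_linear.has_vector_derivative[OF bounded_linear_Re])
    then show ?thesis by (simp add: f_def[abs_def] f'_def)
  qed
  have f_int: "(f' k has_integral (f k x - f k 0)) {0..x}" for k
    using deriv by (intro fundamental_theorem_of_calculus x)
  have f'_lim: "(\<lambda>k. f' k y) \<longlonglongrightarrow> g y" if "y \<in> {0..x}" for y
  proof (cases "y \<in> {0, 1}")
    case True
    then have "e y = 1" by (auto simp: e_def exp_eq_1 complex_eq_iff)
    then have "f' k y = 0" for k
      using r01[of k] Ln_of_real[of "1 - r k"] by (simp add: f'_def)
    with True show ?thesis by (simp add: g_def)
  next
    case False
    with that x have y: "0 < y" "y < 1" by auto
    have "Re (e y) < 1"
    proof -
      have "cos (2 * (pi * y)) = 1 - 2 * sin (pi * y) ^ 2" by (rule cos_double_sin)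
      moreover have "sin (pi * y) > 0" using y by (intro sin_gt_zero) auto
      ultimately show ?thesis by (simp add: e_def Re_exp mult_ac)
    qed
    then have "1 - e y \<notin> \<real>\<^sub>\<le>\<^sub>0" by (auto simp: complex_nonpos_Reals_iff)
    then have "(\<lambda>k. Ln (1 - of_real (r k) * e y)) \<longlonglongrightarrow> Ln (1 - e y)"
      by (intro tendsto_Ln tendsto_diff tendsto_const z_lim)
    then have "(\<lambda>k. f' k y) \<longlonglongrightarrow> 2 * pi * Im (Ln (1 - e y))"
      unfolding f'_def by (intro tendsto_mult tendsto_const tendsto_Im)
    also have "2 * pi * Im (Ln (1 - e y)) = g y"
      unfolding e_def Im_Ln_one_minus_exp[OF y]
      using False by (simp add: g_def power2_eq_square algebra_simps)
    finally show ?thesis .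
  qed
  \<comment> \<open>The imaginary part of the principal logarithm is at most \<open>pi\<close> in
    absolute value, which gives a bound independent of \<open>k\<close> and \<open>y\<close> for
    dominated convergence.\<close>
  have le: "norm (f' k y) \<le> 2 * pi * pi" for k y
  proof -
    have "1 - of_real (r k) * e y \<noteq> 0" using z1[of k y] by auto
    then have "\<bar>Im (Ln (1 - of_real (r k) * e y))\<bar> \<le> pi"
      using mpi_less_Im_Ln Im_Ln_le_pi by (smt (verit))
    then show ?thesis by (simp add: f'_def abs_mult)
  qed
  have "(\<lambda>k. integral {0..x} (f' k)) \<longlonglongrightarrow> integral {0..x} g"
    by (rule dominated_convergence(2)[where h = "\<lambda>_. 2 * pi * pi"])
       (use f_int le f'_lim in \<open>auto simp: has_integral_integrable\<close>)
  then have "(\<lambda>k. f k x - f k 0) \<longlonglongrightarrow> integral {0..x} g"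
    unfolding integral_unique[OF f_int] .
  then have "Re (dilog (e x)) - Re (dilog (e 0)) = integral {0..x} g"
    using tendsto_diff[OF f_lim f_lim] LIMSEQ_unique by blast
  also have "integral {0..x} g = pi\<^sup>2 * (x\<^sup>2 - x)"
  proof (rule integral_unique)
    have "((\<lambda>y. pi\<^sup>2 * (2 * y - 1)) has_integral pi\<^sup>2 * (x\<^sup>2 - x) - pi\<^sup>2 * (0\<^sup>2 - 0)) {0..x}"
      by (rule fundamental_theorem_of_calculus[OF x(1)])
         (auto intro!: derivative_eq_intros simp: has_real_derivative_iff_has_vector_derivative[symmetric])
    then have "((\<lambda>y. pi\<^sup>2 * (2 * y - 1)) has_integral pi\<^sup>2 * (x\<^sup>2 - x)) {0..x}" by simp
    then show "(g has_integral pi\<^sup>2 * (x\<^sup>2 - x)) {0..x}"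
      by (rule has_integral_spike_finite[of "{0, 1}", rotated 2]) (auto simp: g_def)
  qed
  \<comment> \<open>The constant of integration is the Basel sum.\<close>
  also have "Re (dilog (e 0)) = pi\<^sup>2 / 6"
  proof -
    have "(\<lambda>m. Re (1 ^ m / of_nat m ^ 2)) sums Re (dilog 1)"
      by (intro sums_Re dilog_sums) simp
    then have "(\<lambda>m. 1 / real m ^ 2) sums Re (dilog 1)"
      by (simp only: Re_dilog_term) simp
    then have "(\<lambda>m. 1 / real (Suc m) ^ 2) sums Re (dilog 1)"
      by (subst sums_Suc_iff) simp
    then show ?thesis
      using inverse_squares_sums by (simp add: e_def sums_iff add.commute)
  qed
  finally show ?thesis unfolding e_def by (simp add: algebra_simps)
qed

text \<open>This is \<open>Re_dilog_exp\<close> written termwise and divided by \<open>pi^2\<close>.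
  The zero term at \<open>m = 0\<close> is dropped, so the indexing matches that of
  \<open>riemann_zeta\<close>.\<close>

theorem bernoulli_2_fourier_sums:
  fixes x :: real
  assumes "0 \<le> x" "x \<le> 1"
  shows "(\<lambda>m. cos (2 * pi * real (Suc m) * x) / (pi * real (Suc m))\<^sup>2) sums (x\<^sup>2 - x + 1 / 6)"
proof -
  have "(\<lambda>m. Re (exp (2 * pi * \<i> * x) ^ m / of_nat m ^ 2)) sums (pi\<^sup>2 * (x\<^sup>2 - x + 1 / 6))"
    unfolding Re_dilog_exp[OF assms, symmetric]
    by (intro sums_Re dilog_sums) (simp add: norm_exp_eq_Re)
  also have "(\<lambda>m. Re (exp (2 * pi * \<i> * x) ^ m / of_nat m ^ 2)) = (\<lambda>m. cos (2 * pi * real m * x) / real m ^ 2)"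
  proof
    fix m
    have "exp (2 * pi * \<i> * x) ^ m = cis (2 * pi * real m * x)"
      by (simp add: exp_of_nat_mult[symmetric] cis_conv_exp mult_ac)
    then show "Re (exp (2 * pi * \<i> * x) ^ m / of_nat m ^ 2) = cos (2 * pi * real m * x) / real m ^ 2"
      by (simp add: Re_dilog_term)
  qed
  finally have "(\<lambda>m. cos (2 * pi * real (Suc m) * x) / real (Suc m) ^ 2) sums (pi\<^sup>2 * (x\<^sup>2 - x + 1 / 6))"
    by (subst sums_Suc_iff) simp
  from sums_divide[OF this, of "pi\<^sup>2"] show ?thesis
    by (simp add: power_mult_distrib mult_ac)
qed

section \<open>Integrals over the unit interval\<close>

lemma integral_unif_FTC:
  fixes F :: "real \<Rightarrow> 'a::euclidean_space"
  assumes "\<And>x. (F has_vector_derivative f x) (at x)" "continuous_on UNIV f"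
  shows "(\<integral>x. f x \<partial>uniform_measure lborel {0..<1}) = F 1 - F 0"
proof -
  have "uniform_measure lborel {0..<1::real} = density lborel (\<lambda>x. ennreal (indicator {0..1} x))"
    unfolding uniform_measure_def
  proof (rule density_cong)
    \<comment> \<open>The half-open interval is replaced by the closed one needed for the
      fundamental theorem; the point 1 is a null set.\<close>
    have "AE x in lborel. x \<noteq> (1::real)" by (rule AE_lborel_singleton)
    then show "AE x in lborel. indicator {0..<1} x / emeasure lborel {0..<1::real} = ennreal (indicator {0..1::real} x)"
      by (rule eventually_mono) (auto simp: indicator_def divide_ennreal_def)
  qed auto
  moreover have "f \<in> borel_measurable borel" by (rule borel_measurable_continuous_onI) fact
  ultimately have "(\<integral>x. f x \<partial>uniform_measure lborel {0..<1}) = (\<integral>x. indicator {0..1} x *\<^sub>R f x \<partial>lborel)"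
    by (simp add: integral_density)
  also have "\<dots> = F 1 - F 0"
    using assms by (intro integral_FTC_Icc) (auto intro: has_vector_derivative_at_within continuous_on_subset)
  finally show ?thesis .
qed

lemma integral_unif_bernoulli_2: "(\<integral>x. x\<^sup>2 - x + 1 / 6 \<partial>uniform_measure lborel {0..<1::real}) = 0"
  by (subst integral_unif_FTC[where F = "\<lambda>x. x ^ 3 / 3 - x\<^sup>2 / 2 + x / 6"])
     (auto intro!: derivative_eq_intros continuous_intros
       simp: has_real_derivative_iff_has_vector_derivative[symmetric])

lemma integral_unif_bernoulli_2_exp:
  fixes m :: nat
  assumes "m > 0"
  shows "(\<integral>x. of_real (x\<^sup>2 - x + 1 / 6) * exp (- (2 * pi * \<i> * m) * of_real x)
    \<partial>uniform_measure lborel {0..<1::real}) = complex_of_real (1 / (2 * pi\<^sup>2 * real m ^ 2))"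
proof -
  define a where "a = 2 * pi * \<i> * m"
  have a: "a \<noteq> 0" using assms by (simp add: a_def)
  \<comment> \<open>Antiderivative from repeated integration by parts: the quadratic and its first
    and second derivatives, over successive powers of \<open>a\<close>.\<close>
  define F where "F w = - ((w\<^sup>2 - w + 1 / 6) / a + (2 * w - 1) / a\<^sup>2 + 2 / a ^ 3) * exp (- a * w)" for w
  have "(F has_field_derivative (w\<^sup>2 - w + 1 / 6) * exp (- a * w)) (at w)" for w
    unfolding F_def using a
    by (auto intro!: derivative_eq_intros simp: field_simps power2_eq_square power3_eq_cube)
  then have "((\<lambda>x. F (of_real x)) has_vector_derivative
      of_real (x\<^sup>2 - x + 1 / 6) * exp (- a * of_real x)) (at x)" for x :: real
    using has_vector_derivative_real_field[of F] by simp
  then have "(\<integral>x. of_real (x\<^sup>2 - x + 1 / 6) * exp (- a * of_real x) \<partial>uniform_measure lborel {0..<1::real}) =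
      F (of_real 1) - F (of_real 0)"
    by (rule integral_unif_FTC) (intro continuous_intros)
  \<comment> \<open>As \<open>exp (- a) = 1\<close>, the first and third summands of
    \<open>F\<close> agree at 0 and 1; only the jump of \<open>2 w - 1\<close> from -1 to 1
    remains.\<close>
  also have "\<dots> = - 2 / a\<^sup>2"
  proof -
    have "exp a = 1" unfolding a_def using exp_integer_2pi[of "of_nat m"] by (simp add: mult_ac)
    then have "exp (- a) = 1" by (simp add: exp_minus)
    then show ?thesis by (simp add: F_def diff_divide_distrib)
  qed
  also have "\<dots> = complex_of_real (1 / (2 * pi\<^sup>2 * real m ^ 2))"
    by (simp add: a_def power_mult_distrib)
  finally show ?thesis unfolding a_def .
qed

section \<open>The expansion of \<open>Q\<^sub>j\<close>\<close>

text \<open>Boundedness is only required on the cube: both measures under comparison live there.\<close>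

definition tame :: "nat \<Rightarrow> ((nat \<Rightarrow> real) \<Rightarrow> real) \<Rightarrow> bool" where
  "tame n f \<longleftrightarrow> f \<in> borel_measurable (PiM {1..n} (\<lambda>_. borel)) \<and>
     (\<exists>C. \<forall>\<theta>\<in>{1..n} \<rightarrow>\<^sub>E {0..<1}. \<bar>f \<theta>\<bar> \<le> C)"

lemma tame_const: "tame n (\<lambda>_. c)"
  by (auto simp: tame_def)

lemma tame_add:
  assumes "tame n f" "tame n g"
  shows "tame n (\<lambda>\<theta>. f \<theta> + g \<theta>)"
proof -
  from assms obtain C D where "\<forall>\<theta>\<in>{1..n} \<rightarrow>\<^sub>E {0..<1}. \<bar>f \<theta>\<bar> \<le> C" "\<forall>\<theta>\<in>{1..n} \<rightarrow>\<^sub>E {0..<1}. \<bar>g \<theta>\<bar> \<le> D"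
    by (auto simp: tame_def)
  then have "\<forall>\<theta>\<in>{1..n} \<rightarrow>\<^sub>E {0..<1}. \<bar>f \<theta> + g \<theta>\<bar> \<le> C + D"
    by (meson abs_triangle_ineq add_mono order_trans)
  with assms show ?thesis by (auto simp: tame_def)
qed

lemma tame_mult:
  assumes "tame n f" "tame n g"
  shows "tame n (\<lambda>\<theta>. f \<theta> * g \<theta>)"
proof -
  from assms obtain C D where *: "\<forall>\<theta>\<in>{1..n} \<rightarrow>\<^sub>E {0..<1}. \<bar>f \<theta>\<bar> \<le> C" "\<forall>\<theta>\<in>{1..n} \<rightarrow>\<^sub>E {0..<1}. \<bar>g \<theta>\<bar> \<le> D"
    by (auto simp: tame_def)
  have "\<bar>f \<theta> * g \<theta>\<bar> \<le> C * D" if "\<theta> \<in> {1..n} \<rightarrow>\<^sub>E {0..<1}" for \<theta>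
    unfolding abs_mult using * that by (intro mult_mono) (auto intro: order_trans[OF abs_ge_zero])
  with assms show ?thesis by (auto simp: tame_def)
qed

lemma tame_sum:
  assumes "finite A" "\<And>a. a \<in> A \<Longrightarrow> tame n (f a)"
  shows "tame n (\<lambda>\<theta>. \<Sum>a\<in>A. f a \<theta>)"
  using assms by (induction A rule: finite_induct) (auto intro: tame_const tame_add)

lemma tame_prod:
  assumes "finite A" "\<And>a. a \<in> A \<Longrightarrow> tame n (f a)"
  shows "tame n (\<lambda>\<theta>. \<Prod>a\<in>A. f a \<theta>)"
  using assms by (induction A rule: finite_induct) (auto intro: tame_const tame_mult)

text \<open>The bound comes from compactness of the closed interval \<open>{0..1}\<close>, which
  contains every coordinate of a point of the cube.\<close>

lemma tame_component:
  assumes "i \<in> {1..n}" "continuous_on UNIV g"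
  shows "tame n (\<lambda>\<theta>. g (\<theta> i))"
proof -
  have "compact (g ` {0..1})"
    using assms(2) by (intro compact_continuous_image continuous_on_subset[OF assms(2)]) auto
  then obtain C where C: "\<forall>x\<in>{0..1}. \<bar>g x\<bar> \<le> C"
    by (auto dest!: compact_imp_bounded simp: bounded_iff)
  have "\<theta> i \<in> {0..1}" if "\<theta> \<in> {1..n} \<rightarrow>\<^sub>E {0..<1}" for \<theta> :: "nat \<Rightarrow> real"
    using PiE_mem[OF that assms(1)] by (simp add: less_imp_le)
  then have "\<forall>\<theta>\<in>{1..n} \<rightarrow>\<^sub>E {0..<1}. \<bar>g (\<theta> i)\<bar> \<le> C"
    using C by blast
  moreover have "(\<lambda>\<theta>. g (\<theta> i)) \<in> borel_measurable (PiM {1..n} (\<lambda>_. borel))"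
    using borel_measurable_continuous_onI[OF assms(2)] assms(1) by measurable
  ultimately show ?thesis unfolding tame_def by blast
qed

definition tame_fps :: "nat \<Rightarrow> ((nat \<Rightarrow> real) \<Rightarrow> real fps) \<Rightarrow> bool" where
  "tame_fps n F \<longleftrightarrow> (\<forall>j. tame n (\<lambda>\<theta>. fps_nth (F \<theta>) j))"

lemma tame_fps_const: "tame_fps n (\<lambda>_. c)"
  by (simp add: tame_fps_def tame_const)

lemma tame_fps_mult:
  assumes "tame_fps n F" "tame_fps n G"
  shows "tame_fps n (\<lambda>\<theta>. F \<theta> * G \<theta>)"
  using assms unfolding tame_fps_def fps_mult_nth by (auto intro!: tame_sum tame_mult)

lemma tame_fps_diff:
  assumes "tame_fps n F" "tame_fps n G"
  shows "tame_fps n (\<lambda>\<theta>. F \<theta> - G \<theta>)"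
proof -
  have "tame n (\<lambda>\<theta>. fps_nth (F \<theta>) j + (-1) * fps_nth (G \<theta>) j)" for j
    using assms unfolding tame_fps_def by (intro tame_add tame_mult tame_const) auto
  then show ?thesis by (simp add: tame_fps_def)
qed

lemma tame_fps_prod:
  assumes "finite A" "\<And>a. a \<in> A \<Longrightarrow> tame_fps n (F a)"
  shows "tame_fps n (\<lambda>\<theta>. \<Prod>a\<in>A. F a \<theta>)"
  using assms by (induction A rule: finite_induct) (auto intro: tame_fps_const tame_fps_mult)

text \<open>Each coefficient of a composition is a finite linear combination of coefficients of
  powers of the inner series.\<close>

lemma tame_fps_compose:
  assumes "tame_fps n F"
  shows "tame_fps n (\<lambda>\<theta>. a oo F \<theta>)"
proof -
  have "tame_fps n (\<lambda>\<theta>. F \<theta> ^ i)" for i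
    by (induction i) (auto intro: tame_fps_const tame_fps_mult assms)
  then show ?thesis
    unfolding tame_fps_def fps_compose_nth by (auto intro!: tame_sum tame_mult tame_const)
qed

section \<open>Factorization and subset expansion of the generating function\<close>

definition factor_fps :: "(nat \<Rightarrow> real) \<Rightarrow> nat \<Rightarrow> real \<Rightarrow> real fps" where
  "factor_fps p i x = fps_exp 1 oo Abs_fps (\<lambda>k. if k = 0 then 0 else
     (-1) ^ k / (real k * (real k + 1)) * (bernoulli_poly (k + 1) (1 - x) / p i ^ k))"

definition const_fps :: "real fps" where
  "const_fps = fps_exp 1 oo Abs_fps (\<lambda>k. if k = 0 then 0 else
     (-1) ^ (k + 1) / (real k * (real k + 1)) * bernoulli_poly (k + 1) 0)"

text \<open>The exponent is a constant series plus \<open>n\<close> series, each in a single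
  coordinate, and the exponential turns this sum into a product. The minus sign inside
  \<open>c_coeff\<close> turns \<open>(-1) ^ (k + 1)\<close> into the \<open>(-1) ^ k\<close> of
  \<open>factor_fps\<close>.\<close>

lemma Q_coeff_eq_prod: "Q_coeff n p j \<theta> = fps_nth (const_fps * (\<Prod>i=1..n. factor_fps p i (\<theta> i))) j"
proof -
  let ?a = "Abs_fps (\<lambda>k. if k = 0 then 0 else
     (-1) ^ (k + 1) / (real k * (real k + 1)) * bernoulli_poly (k + 1) 0)"
  let ?b = "\<lambda>i. Abs_fps (\<lambda>k. if k = 0 then 0 else
     (-1) ^ k / (real k * (real k + 1)) * (bernoulli_poly (k + 1) (1 - \<theta> i) / p i ^ k))"
  have "Abs_fps (\<lambda>k. if k = 0 then 0 else c_coeff n p k \<theta>) = ?a + (\<Sum>i=1..n. ?b i)"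
    by (rule fps_ext)
       (simp add: c_coeff_def fps_sum_nth sum_distrib_left sum_subtractf right_diff_distrib sum_negf[symmetric])
  then show ?thesis
    unfolding Q_coeff_def const_fps_def factor_fps_def
    by (simp add: fps_exp_compose_add fps_exp_compose_sum fps_sum_nth)
qed

lemma const_fps_0 [simp]: "fps_nth const_fps 0 = 1"
  by (simp add: const_fps_def)

lemma factor_fps_0 [simp]: "fps_nth (factor_fps p i x) 0 = 1"
  by (simp add: factor_fps_def)

text \<open>The linear coefficient of the exponential is that of its exponent, and
  \<open>B_2(1 - x) = B_2(x)\<close>. If \<open>p i = 0\<close>, both sides are 0 by the convention
  for division.\<close>

lemma factor_fps_1: "fps_nth (factor_fps p i x) 1 = - (x\<^sup>2 - x + 1/6) / (2 * p i)"
  by (simp add: factor_fps_def fps_compose_nth bernoulli_poly_2[unfolded numeral_2_eq_2])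
     (cases "p i = 0"; simp add: field_simps power2_eq_square)

lemma tame_fps_factor:
  assumes "i \<in> {1..n}"
  shows "tame_fps n (\<lambda>\<theta>. factor_fps p i (\<theta> i))"
  unfolding factor_fps_def
proof (rule tame_fps_compose, unfold tame_fps_def, rule allI)
  fix k
  show "tame n (\<lambda>\<theta>. fps_nth (Abs_fps (\<lambda>k. if k = 0 then 0 else (-1) ^ k / (real k * (real k + 1)) *
      (bernoulli_poly (k + 1) (1 - \<theta> i) / p i ^ k))) k)"
  proof (cases "k = 0")
    case False
    have "tame n (\<lambda>\<theta>. ((-1) ^ k / (real k * (real k + 1)) * inverse (p i ^ k)) *
        bernoulli_poly (k + 1) (1 - \<theta> i))"
      using assms by (intro tame_mult tame_const tame_component[where g = "\<lambda>x. bernoulli_poly (k + 1) (1 - x)"])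
        (auto intro!: continuous_intros)
    with False show ?thesis by (simp add: divide_inverse mult_ac)
  qed (simp add: tame_const)
qed

definition subset_term :: "(nat \<Rightarrow> real) \<Rightarrow> nat \<Rightarrow> nat set \<Rightarrow> (nat \<Rightarrow> real) \<Rightarrow> real" where
  "subset_term p j S \<theta> = fps_nth (const_fps * (\<Prod>i\<in>S. factor_fps p i (\<theta> i) - 1)) j"

lemma Q_coeff_eq_subset_terms: "Q_coeff n p j \<theta> = (\<Sum>S\<in>Pow {1..n}. subset_term p j S \<theta>)"
proof -
  have "(\<Prod>i=1..n. factor_fps p i (\<theta> i)) = (\<Prod>i=1..n. (factor_fps p i (\<theta> i) - 1) + 1)" by simp
  also have "\<dots> = (\<Sum>S\<in>Pow {1..n}. \<Prod>i\<in>S. factor_fps p i (\<theta> i) - 1)"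
    by (subst prod_add) auto
  finally show ?thesis
    by (simp add: Q_coeff_eq_prod subset_term_def sum_distrib_left fps_sum_nth)
qed

lemma tame_subset_term:
  assumes "S \<subseteq> {1..n}"
  shows "tame n (subset_term p j S)"
proof -
  have "finite S" using assms finite_subset by blast
  then have "tame_fps n (\<lambda>\<theta>. const_fps * (\<Prod>i\<in>S. factor_fps p i (\<theta> i) - 1))"
    using assms by (intro tame_fps_mult tame_fps_const tame_fps_prod tame_fps_diff tame_fps_factor) auto
  then show ?thesis by (simp add: tame_fps_def subset_term_def[abs_def])
qed

text \<open>The product over all \<open>n\<close> coordinates has order at least \<open>n\<close>,
  so up to degree \<open>n\<close> only the constant term 1 of \<open>const_fps\<close> can
  contribute.\<close>

lemma subset_term_full:
  assumes "j \<le> n"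
  shows "subset_term p j {1..n} \<theta> =
    (if j = n then \<Prod>i=1..n. - ((\<theta> i)\<^sup>2 - \<theta> i + 1/6) / (2 * p i) else 0)"
proof -
  let ?P = "\<Prod>i=1..n. factor_fps p i (\<theta> i) - 1"
  have P: "\<forall>j<n. fps_nth ?P j = 0" "fps_nth ?P n = (\<Prod>i=1..n. - ((\<theta> i)\<^sup>2 - \<theta> i + 1/6) / (2 * p i))"
    using fps_nth_prod_lowest[of "{1..n}" "\<lambda>i. factor_fps p i (\<theta> i) - 1"]
    by (auto simp: factor_fps_1[unfolded One_nat_def])
  have "subset_term p j {1..n} \<theta> = (\<Sum>k=0..j. fps_nth const_fps k * fps_nth ?P (j - k))"
    by (simp add: subset_term_def fps_mult_nth)
  also have "\<dots> = (\<Sum>k=0..j. if k = 0 then fps_nth ?P j else 0)"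
    using P(1) assms by (intro sum.cong) auto
  also have "\<dots> = fps_nth ?P j" by simp
  finally show ?thesis using P assms by auto
qed

section \<open>Integration over \<open>H\<close>\<close>

lemma haar_prob_H_space:
  assumes "haar_prob_H n \<mu>"
  shows "space \<mu> = torus_H n"
proof -
  have "space \<mu> = space (borel_H n)"
    using assms by (intro sets_eq_imp_space_eq) (simp add: haar_prob_H_def)
  then show ?thesis by (auto simp: borel_H_def space_restrict_space space_PiM torus_H_def)
qed

lemma haar_prob_H_measurable:
  assumes "haar_prob_H n \<mu>" "f \<in> measurable (PiM {1..n} (\<lambda>_. borel)) N"
  shows "f \<in> measurable \<mu> N"
proof -
  have "f \<in> measurable (borel_H n) N"
    unfolding borel_H_def using assms(2) by (rule measurable_restrict_space1)
  then show ?thesis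
    using assms(1) measurable_cong_sets[of \<mu> "borel_H n" N N] by (simp add: haar_prob_H_def)
qed

lemma torus_add_commute: "torus_add n s t = torus_add n t s"
  by (simp add: torus_add_def add.commute)

lemma torus_add_in_cube: "torus_add n s t \<in> {1..n} \<rightarrow>\<^sub>E {0..<1}"
  by (auto simp: torus_add_def frac_lt_1)

text \<open>The coordinates other than \<open>k\<close> may be prescribed freely modulo 1;
  coordinate \<open>k\<close> is then solved from the condition that the sum be an integer.\<close>

lemma torus_H_translation:
  assumes "k \<in> {1..n}"
  obtains t where "t \<in> torus_H n" "\<And>i. i \<in> {1..n} - {k} \<Longrightarrow> t i - s i \<in> \<int>"
proof
  define t where "t = (\<lambda>i\<in>{1..n}. if i = k then frac (- (\<Sum>i\<in>{1..n} - {k}. frac (s i))) else frac (s i))"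
  have "(\<Sum>i=1..n. t i) = t k + (\<Sum>i\<in>{1..n} - {k}. t i)"
    using assms by (intro sum.remove) auto
  also have "(\<Sum>i\<in>{1..n} - {k}. t i) = (\<Sum>i\<in>{1..n} - {k}. frac (s i))"
    by (intro sum.cong) (auto simp: t_def)
  also have "t k + (\<Sum>i\<in>{1..n} - {k}. frac (s i)) =
      - ((- (\<Sum>i\<in>{1..n} - {k}. frac (s i))) - frac (- (\<Sum>i\<in>{1..n} - {k}. frac (s i))))"
    using assms by (simp add: t_def)
  also have "\<dots> \<in> \<int>" by (intro Ints_minus diff_frac_Ints)
  finally show "t \<in> torus_H n"
    by (auto simp: torus_H_def) (auto simp: t_def frac_lt_1)
  show "t i - s i \<in> \<int>" if "i \<in> {1..n} - {k}" for i
    using that Ints_minus[OF diff_frac_Ints[of "s i"]] by (auto simp: t_def)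
qed

text \<open>
  Averaging the invariance of \<open>\<mu>\<close> over translations by uniformly distributed \<open>s\<close> and applying
  Fubini replaces \<open>\<mu>\<close> by the uniform measure; \<open>s\<close> itself need not lie in \<open>H\<close>, but it may be
  corrected in the coordinate \<open>k\<close>, which the integrand does not see.
\<close>

lemma haar_integral_eq_unif:
  fixes f :: "(nat \<Rightarrow> real) \<Rightarrow> 'b::{banach, second_countable_topology}"
  assumes \<mu>: "haar_prob_H n \<mu>" and k: "k \<in> {1..n}"
    and f: "f \<in> borel_measurable (PiM {1..n} (\<lambda>_. borel))"
    and bound: "\<And>\<theta>. \<theta> \<in> {1..n} \<rightarrow>\<^sub>E {0..<1} \<Longrightarrow> norm (f \<theta>) \<le> C"
    and indep: "\<And>\<theta> \<theta>'. (\<And>i. i \<in> {1..n} - {k} \<Longrightarrow> \<theta> i = \<theta>' i) \<Longrightarrow> f \<theta> = f \<theta>'"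
  shows "(\<integral>\<theta>. f \<theta> \<partial>\<mu>) = (\<integral>\<theta>. f \<theta> \<partial>unif_power n)"
proof -
  let ?B = "PiM {1..n} (\<lambda>_. borel :: real measure)"
  have sets_\<mu>: "sets \<mu> = sets (borel_H n)" and "prob_space \<mu>"
    and inv: "\<And>t. t \<in> torus_H n \<Longrightarrow> distr \<mu> \<mu> (torus_add n t) = \<mu>"
    using \<mu> by (auto simp: haar_prob_H_def)
  interpret \<mu>: prob_space \<mu> by fact
  interpret U: prob_space "unif_power n" by (rule prob_space_unif_power)
  interpret P: pair_prob_space "unif_power n" \<mu> ..
  have id: "(\<lambda>x. x) \<in> measurable \<mu> ?B"
    using measurable_ident by (intro haar_prob_H_measurable[OF \<mu>]) (simp add: id_def)
  have idU: "(\<lambda>x. x) \<in> measurable (unif_power n) ?B"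
    by (rule measurable_ident_sets) (rule sets_unif_power)
  have cU: "(\<lambda>x. x i) \<in> borel_measurable (unif_power n)" if "i \<in> {1..n}" for i
    using measurable_compose[OF idU measurable_component_singleton[OF that]] by simp
  have c\<mu>: "(\<lambda>x. x i) \<in> borel_measurable \<mu>" if "i \<in> {1..n}" for i
    using measurable_compose[OF id measurable_component_singleton[OF that]] by simp
  have meas2: "(\<lambda>(s, \<theta>). torus_add n s \<theta>) \<in> measurable (unif_power n \<Otimes>\<^sub>M \<mu>) ?B"
    unfolding torus_add_def split_beta
  proof (rule measurable_restrict)
    fix i assume i: "i \<in> {1..n}"
    show "(\<lambda>x. frac (fst x i + snd x i)) \<in> borel_measurable (unif_power n \<Otimes>\<^sub>M \<mu>)"
      using measurable_compose[OF measurable_fst cU[OF i]] measurable_compose[OF measurable_snd c\<mu>[OF i]]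
      by (intro measurable_compose[OF _ measurable_frac] borel_measurable_add)
  qed
  have fm: "f \<in> borel_measurable \<mu>" using measurable_compose[OF id f] .
  have fU: "f \<in> borel_measurable (unif_power n)" using measurable_compose[OF idU f] .
  have T\<mu>: "torus_add n t \<in> measurable \<mu> \<mu>" if "t \<in> torus_H n" for t
  proof -
    have "torus_add n t \<in> measurable (borel_H n) (borel_H n)"
      unfolding borel_H_def
      by (intro measurable_restrict_space2 measurable_restrict_space1 measurable_torus_add)
         (use that torus_add_in_H in \<open>auto simp: space_restrict_space\<close>)
    then show ?thesis by (simp add: measurable_cong_sets[OF sets_\<mu> sets_\<mu>])
  qed
  have TU: "torus_add n t \<in> measurable (unif_power n) (unif_power n)" for t
    using measurable_torus_add by (simp cong: measurable_cong_sets add: sets_unif_power)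
  have transl_\<mu>: "(\<integral>\<theta>. f (torus_add n s \<theta>) \<partial>\<mu>) = (\<integral>\<theta>. f \<theta> \<partial>\<mu>)" for s
  proof -
    obtain t where t: "t \<in> torus_H n" "\<And>i. i \<in> {1..n} - {k} \<Longrightarrow> t i - s i \<in> \<int>"
      using torus_H_translation[OF k, of s] by blast
    \<comment> \<open>Off coordinate \<open>k\<close> the vectors \<open>s\<close> and
      \<open>t\<close> agree modulo 1, and \<open>f\<close> does not depend on coordinate
      \<open>k\<close>.\<close>
    have "f (torus_add n s \<theta>) = f (torus_add n t \<theta>)" for \<theta>
      by (rule indep, rule sym) (use t(2) in \<open>auto simp: torus_add_def intro!: frac_cong\<close>)
    then have "(\<integral>\<theta>. f (torus_add n s \<theta>) \<partial>\<mu>) = (\<integral>\<theta>. f (torus_add n t \<theta>) \<partial>\<mu>)" by simp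
    also have "\<dots> = (\<integral>\<theta>. f \<theta> \<partial>distr \<mu> \<mu> (torus_add n t))"
      by (rule integral_distr[symmetric, OF T\<mu>[OF t(1)] fm])
    finally show ?thesis using inv[OF t(1)] by simp
  qed
  \<comment> \<open>Now \<open>\<theta>\<close> is fixed and \<open>s\<close> varies: by
    commutativity \<open>s\<close> is translated by \<open>\<theta>\<close>, which preserves the
    uniform measure.\<close>
  have transl_U: "(\<integral>s. f (torus_add n s \<theta>) \<partial>unif_power n) = (\<integral>\<theta>. f \<theta> \<partial>unif_power n)" for \<theta>
    using integral_distr[OF TU fU, of \<theta>]
    by (simp add: distr_unif_power_torus_add torus_add_commute[of n _ \<theta>])
  have "integrable (unif_power n \<Otimes>\<^sub>M \<mu>) (\<lambda>(s, \<theta>). f (torus_add n s \<theta>))"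
  proof (rule P.integrable_const_bound[of _ C])
    show "AE x in unif_power n \<Otimes>\<^sub>M \<mu>. norm (case x of (s, \<theta>) \<Rightarrow> f (torus_add n s \<theta>)) \<le> C"
      using bound[OF torus_add_in_cube] by (intro AE_I2) (simp add: split_beta)
    show "(\<lambda>(s, \<theta>). f (torus_add n s \<theta>)) \<in> borel_measurable (unif_power n \<Otimes>\<^sub>M \<mu>)"
      using measurable_compose[OF meas2 f] by (simp add: split_beta)
  qed
  \<comment> \<open>Integrating over \<open>s\<close> first gives the uniform mean, integrating over
    \<open>\<theta>\<close> first gives the Haar mean.\<close>
  from P.Fubini_integral[OF this] show ?thesis
    by (simp add: transl_\<mu> transl_U \<mu>.prob_space U.prob_space)
qed

section \<open>Products and integrability under the uniform and Haar measures\<close>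

lemma integral_unif_power_prod:
  fixes g :: "nat \<Rightarrow> real \<Rightarrow> 'a::{real_normed_field, banach, second_countable_topology}"
  assumes "I \<subseteq> {1..n}" "\<And>i. i \<in> I \<Longrightarrow> integrable (uniform_measure lborel {0..<1}) (g i)"
  shows "(\<integral>\<theta>. (\<Prod>i\<in>I. g i (\<theta> i)) \<partial>unif_power n) =
    (\<Prod>i\<in>I. \<integral>x. g i x \<partial>uniform_measure lborel {0..<1})"
proof -
  interpret U: prob_space "uniform_measure lborel {0..<1::real}" by (rule prob_space_unif)
  interpret product_sigma_finite "\<lambda>_::nat. uniform_measure lborel {0..<(1::real)}"
    by (simp add: product_sigma_finite_def U.sigma_finite_measure_axioms)
  \<comment> \<open>Coordinates outside \<open>I\<close> receive the factor 1, whose integral is 1,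
    so that the product formula over all of \<open>{1..n}\<close> applies.\<close>
  define h where "h i = (if i \<in> I then g i else (\<lambda>_. 1))" for i
  have "finite I" using assms(1) finite_subset by blast
  have "(\<Prod>i\<in>I. g i (\<theta> i)) = (\<Prod>i\<in>{1..n}. h i (\<theta> i))" for \<theta>
    using assms(1) by (intro prod.mono_neutral_cong_left) (auto simp: h_def)
  then have "(\<integral>\<theta>. (\<Prod>i\<in>I. g i (\<theta> i)) \<partial>unif_power n) =
      (\<Prod>i\<in>{1..n}. \<integral>x. h i x \<partial>uniform_measure lborel {0..<1})"
    unfolding unif_power_def using assms(2)
    by (simp, subst product_integral_prod) (auto simp: h_def)
  also have "\<dots> = (\<Prod>i\<in>I. \<integral>x. g i x \<partial>uniform_measure lborel {0..<1})"
    using assms(1) by (intro prod.mono_neutral_cong_right) (auto simp: h_def U.prob_space)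
  finally show ?thesis .
qed

lemma integrable_unif_continuous:
  fixes g :: "real \<Rightarrow> 'a::{banach, second_countable_topology}"
  assumes "continuous_on UNIV g"
  shows "integrable (uniform_measure lborel {0..<1}) g"
proof -
  interpret U: prob_space "uniform_measure lborel {0..<1::real}" by (rule prob_space_unif)
  have "compact (g ` {0..1})"
    using assms by (intro compact_continuous_image continuous_on_subset[OF assms]) auto
  then obtain C where C: "\<forall>x\<in>{0..1}. norm (g x) \<le> C"
    by (auto dest!: compact_imp_bounded simp: bounded_iff)
  have "AE x in uniform_measure lborel {0..<1}. norm (g x) \<le> C"
    using C by (intro AE_uniform_measureI) auto
  then show ?thesis
    using borel_measurable_continuous_onI[OF assms]
    by (intro U.integrable_const_bound[of _ C]) auto
qed

text \<open>The space of \<open>unif_power n\<close> consists of all real extensional vectors, so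
  membership in the cube is only almost sure; the Haar measure has \<open>torus_H n\<close> itself
  as its space.\<close>

lemma AE_unif_power_cube: "AE \<theta> in unif_power n. \<theta> \<in> {1..n} \<rightarrow>\<^sub>E {0..<1}"
proof -
  interpret product_sigma_finite "\<lambda>_::nat. uniform_measure lborel {0..<(1::real)}"
    using prob_space_unif by (simp add: product_sigma_finite_def prob_space_imp_sigma_finite)
  have "AE \<theta> in unif_power n. \<forall>i\<in>{1..n}. \<theta> i \<in> {0..<1}"
  proof (rule AE_finite_allI)
    fix i assume i: "i \<in> {1..n}"
    show "AE \<theta> in unif_power n. \<theta> i \<in> {0..<1}"
      unfolding unif_power_def
      using i prob_space_unif by (intro AE_PiM_component AE_uniform_measureI) auto
  qed simp
  with AE_space show ?thesis
    by eventually_elim (auto simp: unif_power_def space_PiM PiE_iff)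
qed

lemma tame_integrable_unif_power:
  assumes "tame n f"
  shows "integrable (unif_power n) f"
proof -
  interpret U: prob_space "unif_power n" by (rule prob_space_unif_power)
  from assms obtain C where C: "\<forall>\<theta>\<in>{1..n} \<rightarrow>\<^sub>E {0..<1}. \<bar>f \<theta>\<bar> \<le> C" by (auto simp: tame_def)
  have "AE \<theta> in unif_power n. norm (f \<theta>) \<le> C"
    using AE_unif_power_cube by eventually_elim (use C in auto)
  moreover have "f \<in> borel_measurable (unif_power n)"
    using assms by (simp add: tame_def measurable_cong_sets[OF sets_unif_power refl])
  ultimately show ?thesis by (intro U.integrable_const_bound[of _ C])
qed

lemma tame_integrable_haar:
  assumes "haar_prob_H n \<mu>" "tame n f"
  shows "integrable \<mu> f"
proof -
  interpret \<mu>: prob_space \<mu> using assms(1) by (simp add: haar_prob_H_def)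
  from assms obtain C where C: "\<forall>\<theta>\<in>{1..n} \<rightarrow>\<^sub>E {0..<1}. \<bar>f \<theta>\<bar> \<le> C" by (auto simp: tame_def)
  have "AE \<theta> in \<mu>. norm (f \<theta>) \<le> C"
  proof (rule AE_I2)
    fix \<theta> assume "\<theta> \<in> space \<mu>"
    then have "\<theta> \<in> {1..n} \<rightarrow>\<^sub>E {0..<1}"
      unfolding haar_prob_H_space[OF assms(1)] torus_H_def by blast
    with C show "norm (f \<theta>) \<le> C" by simp
  qed
  moreover have "f \<in> borel_measurable \<mu>"
    using assms(2) by (intro haar_prob_H_measurable[OF assms(1)]) (simp add: tame_def)
  ultimately show ?thesis by (intro \<mu>.integrable_const_bound[of _ C])
qed

section \<open>The Haar mean of the product of second Bernoulli polynomials\<close>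

definition B2 :: "real \<Rightarrow> real" where
  "B2 x = x\<^sup>2 - x + 1 / 6"

lemma continuous_on_B2 [continuous_intros]:
  "continuous_on S f \<Longrightarrow> continuous_on S (\<lambda>x. B2 (f x))"
  unfolding B2_def by (intro continuous_intros)

lemma abs_B2_le:
  assumes "x \<in> {0..<1}"
  shows "\<bar>B2 x\<bar> \<le> 1"
proof -
  have "0 \<le> x * (1 - x)" using assms by simp
  moreover have "x * (1 - x) \<le> 1 * 1" by (rule mult_mono) (use assms in auto)
  moreover have "B2 x = 1 / 6 - x * (1 - x)" by (simp add: B2_def power2_eq_square algebra_simps)
  ultimately show ?thesis by linarith
qed

text \<open>On \<open>H\<close> the cosine in coordinate \<open>n\<close> is the real part of a
  product of characters in the other coordinates. The integrand thus becomes a function of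
  \<open>n - 1\<close> independent uniform coordinates, and each contributes the same Fourier
  coefficient.\<close>

lemma integral_haar_B2_cos:
  assumes \<mu>: "haar_prob_H n \<mu>" and n: "n \<ge> 1" and m: "m > 0"
  shows "(\<integral>\<theta>. (\<Prod>i\<in>{1..<n}. B2 (\<theta> i)) * cos (2 * pi * real m * \<theta> n) \<partial>\<mu>) =
    (1 / (2 * pi\<^sup>2 * real m ^ 2)) ^ (n - 1)"
proof -
  define a where "a = 2 * pi * \<i> * m"
  define g where "g x = of_real (B2 x) * exp (- a * of_real x)" for x
  have g_cont: "continuous_on S g" for S
    unfolding g_def by (intro continuous_intros)
  have norm_exp: "norm (exp (- a * of_real x)) = 1" for x
    by (simp add: norm_exp_eq_Re a_def)
  have norm_g: "norm (g x) \<le> 1" if "x \<in> {0..<1}" for x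
    unfolding g_def norm_mult norm_exp using abs_B2_le[OF that] by simp
  define f where "f \<theta> = (\<Prod>i\<in>{1..<n}. g (\<theta> i))" for \<theta>
  have f_meas: "f \<in> borel_measurable (PiM {1..n} (\<lambda>_. borel))"
    unfolding f_def[abs_def]
  proof (rule borel_measurable_prod)
    fix i assume "i \<in> {1..<n}"
    then show "(\<lambda>\<theta>. g (\<theta> i)) \<in> borel_measurable (PiM {1..n} (\<lambda>_. borel))"
      by (intro measurable_compose[OF measurable_component_singleton]
          borel_measurable_continuous_onI g_cont) auto
  qed
  have f_le: "norm (f \<theta>) \<le> 1" if "\<theta> \<in> {1..n} \<rightarrow>\<^sub>E {0..<1}" for \<theta>
    unfolding f_def prod_norm[symmetric]
  proof (intro prod_le_1 conjI norm_ge_zero norm_g)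
    fix i assume "i \<in> {1..<n}"
    then show "\<theta> i \<in> {0..<1}" by (intro PiE_mem[OF that]) auto
  qed
  have Re_f: "Re (f \<theta>) = (\<Prod>i\<in>{1..<n}. B2 (\<theta> i)) * cos (2 * pi * real m * \<theta> n)"
    if "\<theta> \<in> space \<mu>" for \<theta>
  proof -
    have "(\<Sum>i=1..n. \<theta> i) \<in> \<int>"
      using that haar_prob_H_space[OF \<mu>] by (simp add: torus_H_def)
    then obtain k where k: "(\<Sum>i=1..n. \<theta> i) = of_int k" by (elim Ints_cases)
    moreover have "{1..n} = insert n {1..<n}" using n by auto
    ultimately have s: "(\<Sum>i\<in>{1..<n}. \<theta> i) = of_int k - \<theta> n" by simp
    have "(\<Prod>i\<in>{1..<n}. exp (- a * of_real (\<theta> i))) = exp (- a * of_real (\<Sum>i\<in>{1..<n}. \<theta> i))"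
      by (simp add: exp_sum sum_distrib_left)
    \<comment> \<open>The coordinates below \<open>n\<close> sum to \<open>k - \<theta> n\<close>
      with \<open>k\<close> an integer; the phase coming from \<open>m k\<close> is a multiple of
      \<open>2 pi\<close> and drops out next.\<close>
    also have "\<dots> = cis (2 * pi * real m * \<theta> n - 2 * pi * of_int (int m * k))"
      unfolding s by (simp add: a_def cis_conv_exp algebra_simps)
    also have "\<dots> = cis (2 * pi * real m * \<theta> n)"
      using cis_multiple_2pi[of "of_int (int m * k)"] by (simp only: cis_divide[symmetric]) simp
    finally have "f \<theta> = of_real (\<Prod>i\<in>{1..<n}. B2 (\<theta> i)) * cis (2 * pi * real m * \<theta> n)"
      by (simp add: f_def g_def prod.distrib)
    then show ?thesis by (simp del: of_real_prod)
  qed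
  interpret \<mu>: prob_space \<mu> using \<mu> by (simp add: haar_prob_H_def)
  have f_int: "integrable \<mu> f"
  proof (rule \<mu>.integrable_const_bound[of _ 1])
    show "AE \<theta> in \<mu>. norm (f \<theta>) \<le> 1"
      using haar_prob_H_space[OF \<mu>] f_le by (intro AE_I2) (simp add: torus_H_def)
  qed (rule haar_prob_H_measurable[OF \<mu> f_meas])
  have "(\<integral>\<theta>. (\<Prod>i\<in>{1..<n}. B2 (\<theta> i)) * cos (2 * pi * real m * \<theta> n) \<partial>\<mu>) = (\<integral>\<theta>. Re (f \<theta>) \<partial>\<mu>)"
    using Re_f by (intro Bochner_Integration.integral_cong) auto
  also have "\<dots> = Re (\<integral>\<theta>. f \<theta> \<partial>\<mu>)" using f_int by simp
  \<comment> \<open>\<open>f\<close> omits coordinate \<open>n\<close>, so the Haar measure may be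
    exchanged for the uniform one.\<close>
  also have "(\<integral>\<theta>. f \<theta> \<partial>\<mu>) = (\<integral>\<theta>. f \<theta> \<partial>unif_power n)"
  proof (rule haar_integral_eq_unif[OF \<mu> _ f_meas f_le])
    show "n \<in> {1..n}" using n by simp
    show "f \<theta> = f \<theta>'" if "\<And>i. i \<in> {1..n} - {n} \<Longrightarrow> \<theta> i = \<theta>' i" for \<theta> \<theta>'
      unfolding f_def using that by (intro prod.cong) auto
  qed
  also have "\<dots> = (\<Prod>i\<in>{1..<n}. \<integral>x. g x \<partial>uniform_measure lborel {0..<1})"
    unfolding f_def by (intro integral_unif_power_prod integrable_unif_continuous g_cont) auto
  also have "(\<integral>x. g x \<partial>uniform_measure lborel {0..<1}) = of_real (1 / (2 * pi\<^sup>2 * real m ^ 2))"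
    unfolding g_def a_def B2_def by (rule integral_unif_bernoulli_2_exp[OF m])
  finally show ?thesis by (simp flip: of_real_power add: of_real_power[symmetric] del: of_real_power)
qed

text \<open>The last factor is expanded into its cosine series and the sum is integrated term by
  term, each term being given by \<open>integral_haar_B2_cos\<close>.\<close>

lemma integral_haar_prod_B2:
  assumes \<mu>: "haar_prob_H n \<mu>" and n: "n \<ge> 1"
  shows "(\<integral>\<theta>. (\<Prod>i=1..n. B2 (\<theta> i)) \<partial>\<mu>) = 2 * riemann_zeta (2 * real n) / (2 * pi\<^sup>2) ^ n"
proof -
  define P where "P \<theta> = (\<Prod>i\<in>{1..<n}. B2 (\<theta> i))" for \<theta>
  define t where "t m \<theta> = P \<theta> * cos (2 * pi * real (Suc m) * \<theta> n) / (pi * real (Suc m))\<^sup>2" for m \<theta>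
  have split: "{1..n} = insert n {1..<n}" using n by auto
  have cube: "\<theta> \<in> {1..n} \<rightarrow>\<^sub>E {0..<1}" if "\<theta> \<in> space \<mu>" for \<theta>
    using that haar_prob_H_space[OF \<mu>] by (simp add: torus_H_def)
  have sums: "(\<lambda>m. t m \<theta>) sums (\<Prod>i=1..n. B2 (\<theta> i))" if "\<theta> \<in> space \<mu>" for \<theta>
  proof -
    have "\<theta> n \<in> {0..<1}" using n by (intro PiE_mem[OF cube[OF that]]) auto
    then have "(\<lambda>m. P \<theta> * (cos (2 * pi * real (Suc m) * \<theta> n) / (pi * real (Suc m))\<^sup>2)) sums (P \<theta> * B2 (\<theta> n))"
      unfolding B2_def by (intro sums_mult bernoulli_2_fourier_sums) auto
    moreover have "(\<Prod>i=1..n. B2 (\<theta> i)) = P \<theta> * B2 (\<theta> n)"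
      unfolding split P_def by simp
    ultimately show ?thesis by (simp add: t_def)
  qed
  have P_le: "\<bar>P \<theta>\<bar> \<le> 1" if "\<theta> \<in> space \<mu>" for \<theta>
    unfolding P_def abs_prod
  proof (intro prod_le_1 conjI abs_ge_zero abs_B2_le)
    fix i assume "i \<in> {1..<n}"
    then show "\<theta> i \<in> {0..<1}" by (intro PiE_mem[OF cube[OF that]]) auto
  qed
  \<comment> \<open>The bound is free of \<open>\<theta>\<close> and summable in \<open>m\<close>,
    which justifies exchanging sum and integral.\<close>
  have t_le: "norm (t m \<theta>) \<le> 1 / (pi * real (Suc m))\<^sup>2" if "\<theta> \<in> space \<mu>" for m \<theta>
  proof -
    have "\<bar>P \<theta>\<bar> * \<bar>cos (2 * pi * real (Suc m) * \<theta> n)\<bar> \<le> 1 * 1"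
      using P_le[OF that] by (intro mult_mono) auto
    then show ?thesis
      unfolding t_def real_norm_def abs_divide abs_mult by (simp add: divide_right_mono)
  qed
  have summ: "summable (\<lambda>m. 1 / (pi * real (Suc m))\<^sup>2)"
  proof -
    have "summable (\<lambda>m. 1 / pi\<^sup>2 * (1 / real (Suc m) ^ 2))"
      using summable_inverse_square by (intro summable_mult) (subst summable_Suc_iff)
    then show ?thesis by (simp add: power_mult_distrib)
  qed
  interpret \<mu>: prob_space \<mu> using \<mu> by (simp add: haar_prob_H_def)
  have t_int: "integrable \<mu> (t m)" for m
  proof (rule tame_integrable_haar[OF \<mu>])
    have "tame n (\<lambda>\<theta>. P \<theta> * (cos (2 * pi * real (Suc m) * \<theta> n) / (pi * real (Suc m))\<^sup>2))"
      unfolding P_def using n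
      by (intro tame_mult tame_prod tame_component[where g = B2]
          tame_component[where g = "\<lambda>x. cos (2 * pi * real (Suc m) * x) / (pi * real (Suc m))\<^sup>2"] continuous_intros)
        auto
    then show "tame n (t m)" by (simp add: t_def[abs_def])
  qed
  have "(\<lambda>m. \<integral>\<theta>. t m \<theta> \<partial>\<mu>) sums (\<integral>\<theta>. (\<Sum>m. t m \<theta>) \<partial>\<mu>)"
  proof (rule sums_integral[OF t_int])
    show "AE \<theta> in \<mu>. summable (\<lambda>m. norm (t m \<theta>))"
    proof (intro AE_I2 summable_comparison_test'[OF summ, of 0])
      show "norm (norm (t m \<theta>)) \<le> 1 / (pi * real (Suc m))\<^sup>2" if "\<theta> \<in> space \<mu>" for m \<theta>
        using t_le[OF that, of m] by simp
    qed
    show "summable (\<lambda>m. \<integral>\<theta>. norm (t m \<theta>) \<partial>\<mu>)"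
    proof (rule summable_comparison_test'[OF summ, of 0])
      fix m
      have "(\<integral>\<theta>. norm (t m \<theta>) \<partial>\<mu>) \<le> (\<integral>\<theta>. 1 / (pi * real (Suc m))\<^sup>2 \<partial>\<mu>)"
        using t_int t_le by (intro integral_mono integrable_norm) auto
      then show "norm (\<integral>\<theta>. norm (t m \<theta>) \<partial>\<mu>) \<le> 1 / (pi * real (Suc m))\<^sup>2"
        by (simp add: \<mu>.prob_space)
    qed
  qed
  also have "(\<integral>\<theta>. (\<Sum>m. t m \<theta>) \<partial>\<mu>) = (\<integral>\<theta>. (\<Prod>i=1..n. B2 (\<theta> i)) \<partial>\<mu>)"
    using sums by (intro Bochner_Integration.integral_cong) (auto simp: sums_iff)
  also have "(\<lambda>m. \<integral>\<theta>. t m \<theta> \<partial>\<mu>) = (\<lambda>m. 2 / (2 * pi\<^sup>2) ^ n * (1 / real (Suc m) powr (2 * real n)))"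
  proof
    fix m
    define M where "M = real (Suc m)"
    have M: "M > 0" by (simp add: M_def)
    obtain k where k: "n = Suc k" using n by (cases n) auto
    have "(\<integral>\<theta>. t m \<theta> \<partial>\<mu>) = (1 / (2 * pi\<^sup>2 * M ^ 2)) ^ (n - 1) / (pi * M)\<^sup>2"
      unfolding t_def P_def M_def using integral_haar_B2_cos[OF \<mu> n, of "Suc m"] by simp
    \<comment> \<open>The series coefficient \<open>1 / (pi M)^2\<close> is twice the Fourier
      coefficient \<open>1 / (2 pi^2 M^2)\<close>, so it supplies the missing \<open>n\<close>-th
      factor and the leading 2.\<close>
    also have "\<dots> = 2 * (1 / (2 * pi\<^sup>2 * M ^ 2)) ^ n"
      using M by (simp add: k power_mult_distrib)
    also have "\<dots> = 2 / (2 * pi\<^sup>2) ^ n * (1 / M ^ (2 * n))"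
      by (simp add: power_mult_distrib power_divide power_mult)
    also have "M ^ (2 * n) = M powr (2 * real n)"
      using M powr_realpow[of M "2 * n"] by simp
    finally show "(\<integral>\<theta>. t m \<theta> \<partial>\<mu>) = 2 / (2 * pi\<^sup>2) ^ n * (1 / real (Suc m) powr (2 * real n))"
      unfolding M_def .
  qed
  finally have *: "(\<lambda>m. 2 / (2 * pi\<^sup>2) ^ n * (1 / real (Suc m) powr (2 * real n))) sums
      (\<integral>\<theta>. (\<Prod>i=1..n. B2 (\<theta> i)) \<partial>\<mu>)" .
  have "(\<lambda>m. 1 / real (Suc m) powr (2 * real n)) sums
      ((\<integral>\<theta>. (\<Prod>i=1..n. B2 (\<theta> i)) \<partial>\<mu>) / (2 / (2 * pi\<^sup>2) ^ n))"
    using * by (rule sums_mult_D) simp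
  then have "riemann_zeta (2 * real n) = (\<integral>\<theta>. (\<Prod>i=1..n. B2 (\<theta> i)) \<partial>\<mu>) / (2 / (2 * pi\<^sup>2) ^ n)"
    unfolding riemann_zeta_def by (rule sums_unique[symmetric])
  then show ?thesis by (simp add: field_simps)
qed

section \<open>Positivity of zeta and the difference of the means\<close>

lemma riemann_zeta_pos:
  assumes "s > 1"
  shows "riemann_zeta s > 0"
proof -
  have "summable (\<lambda>m. real m powr - s)"
    using assms by (subst summable_real_powr_iff) simp
  then have "summable (\<lambda>m. real (Suc m) powr - s)" by (subst summable_Suc_iff)
  then show ?thesis
    unfolding riemann_zeta_def by (intro suminf_pos) (simp_all add: powr_minus_divide)
qed

text \<open>A proper subset \<open>S\<close> misses some coordinate \<open>k\<close>, so its term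
  does not depend on \<open>k\<close> and \<open>haar_integral_eq_unif\<close> cancels its
  contribution. Only the full subset is left.\<close>

lemma integral_Q_coeff_diff:
  assumes \<mu>: "haar_prob_H n \<mu>" and j: "j \<le> n"
  shows "(\<integral>\<theta>. Q_coeff n p j \<theta> \<partial>\<mu>) - (\<integral>\<theta>. Q_coeff n p j \<theta> \<partial>unif_power n) =
    (\<integral>\<theta>. subset_term p j {1..n} \<theta> \<partial>\<mu>) - (\<integral>\<theta>. subset_term p j {1..n} \<theta> \<partial>unif_power n)"
proof -
  define D where "D S = (\<integral>\<theta>. subset_term p j S \<theta> \<partial>\<mu>) - (\<integral>\<theta>. subset_term p j S \<theta> \<partial>unif_power n)" for S
  have D0: "D S = 0" if "S \<in> Pow {1..n} - {{1..n}}" for S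
  proof -
    from that obtain k where k: "k \<in> {1..n}" "k \<notin> S" by blast
    have S: "S \<subseteq> {1..n}" using that by auto
    obtain C where C: "\<forall>\<theta>\<in>{1..n} \<rightarrow>\<^sub>E {0..<1}. \<bar>subset_term p j S \<theta>\<bar> \<le> C"
      using tame_subset_term[OF S, of p j] by (auto simp: tame_def)
    have "(\<integral>\<theta>. subset_term p j S \<theta> \<partial>\<mu>) = (\<integral>\<theta>. subset_term p j S \<theta> \<partial>unif_power n)"
    proof (rule haar_integral_eq_unif[OF \<mu> k(1), where C = C])
      show "subset_term p j S \<in> borel_measurable (PiM {1..n} (\<lambda>_. borel))"
        using tame_subset_term[OF S, of p j] by (simp add: tame_def)
      show "norm (subset_term p j S \<theta>) \<le> C" if "\<theta> \<in> {1..n} \<rightarrow>\<^sub>E {0..<1}" for \<theta>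
        using C that by simp
      fix \<theta> \<theta>' :: "nat \<Rightarrow> real" assume "\<And>i. i \<in> {1..n} - {k} \<Longrightarrow> \<theta> i = \<theta>' i"
      then have "\<theta> i = \<theta>' i" if "i \<in> S" for i using that S k(2) by blast
      then have "(\<Prod>i\<in>S. factor_fps p i (\<theta> i) - 1) = (\<Prod>i\<in>S. factor_fps p i (\<theta>' i) - 1)"
        by (intro prod.cong) auto
      then show "subset_term p j S \<theta> = subset_term p j S \<theta>'" by (simp add: subset_term_def)
    qed
    then show ?thesis by (simp add: D_def)
  qed
  have "(\<integral>\<theta>. Q_coeff n p j \<theta> \<partial>\<mu>) - (\<integral>\<theta>. Q_coeff n p j \<theta> \<partial>unif_power n) = (\<Sum>S\<in>Pow {1..n}. D S)"
    unfolding Q_coeff_eq_subset_terms D_def sum_subtractf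
    by (subst (1 2) Bochner_Integration.integral_sum)
       (auto intro!: tame_integrable_haar[OF \<mu>] tame_integrable_unif_power tame_subset_term)
  also have "\<dots> = (\<Sum>S\<in>{{1..n}}. D S)"
    using D0 by (intro sum.mono_neutral_right) auto
  finally show ?thesis by (simp add: D_def)
qed

theorem corollary6p3:
  fixes n :: nat and p :: "nat \<Rightarrow> real" and \<mu>\<^sub>H :: "(nat \<Rightarrow> real) measure"
  assumes "n \<ge> 2"
    and "\<And>i. i \<in> {1..n} \<Longrightarrow> p i > 0"
    and "(\<Sum>i=1..n. p i) = 1"
    and "generic n p"
    and "haar_prob_H n \<mu>\<^sub>H"
  shows "(\<forall>j\<le>n - 1. (\<integral>\<theta>. Q_coeff n p j \<theta> \<partial>\<mu>\<^sub>H) = (\<integral>\<theta>. Q_coeff n p j \<theta> \<partial>unif_power n))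
    \<and> (\<integral>\<theta>. Q_coeff n p n \<theta> \<partial>\<mu>\<^sub>H) - (\<integral>\<theta>. Q_coeff n p n \<theta> \<partial>unif_power n)
        = (-1) ^ n / (2 ^ n * (\<Prod>i=1..n. p i)) * (2 * riemann_zeta (2 * real n) / (2 * pi\<^sup>2) ^ n)
    \<and> (-1) ^ n / (2 ^ n * (\<Prod>i=1..n. p i)) * (2 * riemann_zeta (2 * real n) / (2 * pi\<^sup>2) ^ n) \<noteq> 0"
proof (intro conjI allI impI)
  have n: "n \<ge> 1" using assms(1) by simp
  fix j assume "j \<le> n - 1"
  with n have "j \<le> n" "j \<noteq> n" by auto
  \<comment> \<open>The full-subset term starts in degree \<open>n\<close>, so nothing remains in
    lower degrees.\<close>
  then have "subset_term p j {1..n} = (\<lambda>_. 0)" by (intro ext) (simp only: subset_term_full if_False)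
  then show "(\<integral>\<theta>. Q_coeff n p j \<theta> \<partial>\<mu>\<^sub>H) = (\<integral>\<theta>. Q_coeff n p j \<theta> \<partial>unif_power n)"
    using integral_Q_coeff_diff[OF assms(5) \<open>j \<le> n\<close>, of p] by simp
next
  have n: "n \<ge> 1" using assms(1) by simp
  \<comment> \<open>\<open>K\<close> collects the constants \<open>-1 / (2 p i)\<close> of the
    \<open>n\<close> linear coefficients.\<close>
  define K where "K = (-1) ^ n / (2 ^ n * (\<Prod>i=1..n. p i))"
  have "(\<Prod>i=1..n. - B2 (\<theta> i) / (2 * p i)) = K * (\<Prod>i=1..n. B2 (\<theta> i))" for \<theta>
  proof -
    have "(\<Prod>i=1..n. - B2 (\<theta> i) / (2 * p i)) = (\<Prod>i=1..n. (- 1) * B2 (\<theta> i)) / (\<Prod>i=1..n. 2 * p i)"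
      by (simp only: prod_dividef mult_minus1)
    also have "\<dots> = K * (\<Prod>i=1..n. B2 (\<theta> i))"
      unfolding prod.distrib K_def by simp
    finally show ?thesis .
  qed
  then have *: "subset_term p n {1..n} \<theta> = K * (\<Prod>i=1..n. B2 (\<theta> i))" for \<theta>
    unfolding subset_term_full[OF order_refl] B2_def by simp
  have "(\<integral>\<theta>. (\<Prod>i=1..n. B2 (\<theta> i)) \<partial>unif_power n) =
      (\<Prod>i=1..n. \<integral>x. B2 x \<partial>uniform_measure lborel {0..<1})"
    by (intro integral_unif_power_prod integrable_unif_continuous continuous_intros) auto
  \<comment> \<open>Each factor has uniform mean 0; \<open>n \<ge> 1\<close> ensures that the
    product is not empty.\<close>
  also have "\<dots> = 0"
    using n integral_unif_bernoulli_2 by (simp add: B2_def power_0_left)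
  finally show "(\<integral>\<theta>. Q_coeff n p n \<theta> \<partial>\<mu>\<^sub>H) - (\<integral>\<theta>. Q_coeff n p n \<theta> \<partial>unif_power n)
        = (-1) ^ n / (2 ^ n * (\<Prod>i=1..n. p i)) * (2 * riemann_zeta (2 * real n) / (2 * pi\<^sup>2) ^ n)"
    unfolding integral_Q_coeff_diff[OF assms(5) order_refl] * K_def[symmetric]
      integral_mult_right_zero integral_haar_prod_B2[OF assms(5) n] by simp
next
  have "\<forall>i\<in>{1..n}. p i \<noteq> 0" using assms(2) by (metis less_irrefl)
  moreover have "riemann_zeta (2 * real n) > 0" using assms(1) by (intro riemann_zeta_pos) simp
  ultimately show "(-1) ^ n / (2 ^ n * (\<Prod>i=1..n. p i)) * (2 * riemann_zeta (2 * real n) / (2 * pi\<^sup>2) ^ n) \<noteq> 0"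
    by simp
qed

end
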